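(* Let $p$ be an odd prime, and let $r = p^{2k}$ and $q = p^{\ell}$, where $k$ and $\ell$ are positive integers with $\operatorname{ord}_2(\ell) \le \operatorname{ord}_2(k)$. Let $a \in \mathbb{F}_q^*$ be a nonsquare in $\mathbb{F}_q^*$, and put \[ f(X) := \frac{E_r(X,a)^{(r+1)/2}}{(X^2-4a)^{(r^2-r)/4}} \in \mathbb{F}_q(X). \] Then $f(X)$ is an indecomposable exceptional rational function in $\mathbb{F}_q(X)$ of degree $(r^2+r)/2$, and $f(X)$ permutes $\mathbb{P}^1(\mathbb{F}_{q^n})$ for each odd positive integer $n$. Moreover, if $r \ne 9$ then $f(X)$ is indecomposable over the algebraic closure $\bar{\mathbb{F}}_q$ of $\mathbb{F}_q$.
   Context: For a positive integer $n$, $\operatorname{ord}_2(n)$ denotes the largest integer $i\ge 0$ with $2^i \mid n$. For $a\in\mathbb{F}_q$ and a positive integer $r$, the Dickson polynomial of the second kind $E_r(X,a)\in\mathbb{F}_q[X]$ is $E_r(X,a)=\sum_{i=0}^{\lfloor r/2\rfloor}\binom{r-i}{i}(-a)^iX^{r-2i}$; equivalently it is the unique polynomial satisfying $E_r(X+a/X,a)=\frac{X^{r+1}-(a/X)^{r+1}}{X-a/X}$. A rational function $f(X)\in\mathbb{F}_q(X)$ is called exceptional if the map $c\mapsto f(c)$ is a bijection of $\mathbb{P}^1(\mathbb{F}_{q^n})$ for infinitely many positive integers $n$. For a field $K$, a rational function $f(X)\in K(X)$ of degree at least $2$ is indecomposable (over $K$) if it cannot be written as $g(h(X))$ with $g,h\in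 K(X)$ each of degree at least $2$. The degree of a rational function is the maximum of the degrees of its numerator and denominator in lowest terms. *)

theory Defs
  imports "HOL-Algebra.Algebraic_Closure_Type" "HOL-Library.Cardinality"
begin

section \<open>Rational functions over a field\<close>

text \<open>
  \<open>K(X)\<close> is the fraction field \<open>'a poly fract\<close> of \<open>K[X]\<close>, with \<open>K\<close> the field type \<open>'a\<close>.
\<close>

text \<open>
  The library's \<open>quot_of_fract\<close> is not available here: it needs a gcd operation on \<open>'a poly\<close>, which
  an arbitrary field type \<open>'a\<close> does not provide.
\<close>

lemma rf_lowest_terms_ex1:
  fixes f :: "'a :: field poly fract"
  shows "\<exists>!(P, Q). coprime P Q \<and> lead_coeff Q = 1 \<and> f = Fract P Q"
proof -
  define R where "R = (\<lambda>(P, Q). Q \<noteq> 0 \<and> f = Fract P Q)"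
  have "\<exists>x. R x"
    by (cases f) (auto simp: R_def)
  then obtain x where x: "R x" "\<And>y. R y \<Longrightarrow> degree (snd x) \<le> degree (snd y)"
    using ex_has_least_nat[of R _ "\<lambda>y. degree (snd y)"] by metis
  obtain P0 Q0 where x_eq: "x = (P0, Q0)" by (cases x)
  have Q0: "Q0 \<noteq> 0" and f0: "f = Fract P0 Q0"
    using x(1) by (auto simp: R_def x_eq)
  have min: "degree Q0 \<le> degree Q" if "Q \<noteq> 0" "f = Fract P Q" for P Q
    using x(2)[of "(P, Q)"] that by (auto simp: R_def x_eq)
  have mult: "\<exists>t. P = P0 * t \<and> Q = Q0 * t" if Q: "Q \<noteq> 0" "f = Fract P Q" for P Q
  proof -
    define t u where "t = Q div Q0" and "u = Q mod Q0"
    have Qeq: "Q = Q0 * t + u" by (simp add: t_def u_def)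
    have cross: "P0 * Q = P * Q0"
      using Q Q0 f0 by (simp add: eq_fract)
    hence key: "(P - P0 * t) * Q0 = P0 * u"
      by (simp add: Qeq algebra_simps)
    have u0: "u = 0"
    proof (rule ccontr)
      assume u: "u \<noteq> 0"
      have "f = Fract (P - P0 * t) u"
        using key u Q0 f0 by (simp add: eq_fract)
      hence "degree Q0 \<le> degree u" using min u by blast
      moreover have "degree u < degree Q0"
        using degree_mod_less[OF Q0, of Q] u by (simp add: u_def)
      ultimately show False by simp
    qed
    with key Q0 have "P = P0 * t" by simp
    with Qeq u0 show ?thesis by auto
  qed
  have cop0: "coprime P0 Q0"
  proof (rule coprimeI)
    fix d assume "d dvd P0" "d dvd Q0"
    then obtain P' Q' where d: "P0 = d * P'" "Q0 = d * Q'" by (auto elim!: dvdE)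
    hence nz: "d \<noteq> 0" "Q' \<noteq> 0" using Q0 by auto
    hence "f = Fract P' Q'" using f0 d by (simp add: eq_fract algebra_simps)
    hence "degree Q0 \<le> degree Q'" using min nz by blast
    moreover have "degree Q0 = degree d + degree Q'"
      using d nz by (simp add: degree_mult_eq)
    ultimately show "is_unit d" using nz by (simp add: is_unit_iff_degree)
  qed
  define c where "c = lead_coeff Q0"
  have c: "c \<noteq> 0" using Q0 by (simp add: c_def)
  define P1 Q1 where "P1 = smult (inverse c) P0" and "Q1 = smult (inverse c) Q0"
  have Q1: "Q1 \<noteq> 0" "lead_coeff Q1 = 1" using c Q0 by (auto simp: Q1_def c_def)
  have f1: "f = Fract P1 Q1"
    using f0 Q0 Q1 by (simp add: eq_fract P1_def Q1_def)
  have cop1: "coprime P1 Q1"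
  proof (rule coprimeI)
    fix d assume "d dvd P1" "d dvd Q1"
    hence "d dvd P0" "d dvd Q0"
      using c by (auto simp: P1_def Q1_def dvd_smult_iff)
    thus "is_unit d" using cop0 by (meson coprime_common_divisor)
  qed
  show ?thesis
  proof (rule ex1I[of _ "(P1, Q1)"])
    show "case (P1, Q1) of (P, Q) \<Rightarrow> coprime P Q \<and> lead_coeff Q = 1 \<and> f = Fract P Q"
      using cop1 Q1 f1 by simp
  next
    fix y assume y: "case y of (P, Q) \<Rightarrow> coprime P Q \<and> lead_coeff Q = 1 \<and> f = Fract P Q"
    obtain P Q where y_eq: "y = (P, Q)" by (cases y)
    have PQ: "coprime P Q" "lead_coeff Q = 1" "f = Fract P Q" "Q \<noteq> 0"
      using y y_eq by auto
    obtain t where t: "P = P0 * t" "Q = Q0 * t" using mult PQ by blast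
    have "is_unit t" using PQ(1) t by (meson coprime_common_divisor dvd_triv_right)
    then obtain s where s: "t = [:s:]" by (auto simp: is_unit_poly_iff)
    have "c * s = 1" using PQ(2) unfolding t s lead_coeff_mult by (simp add: c_def)
    hence "s = inverse c" using c by (simp add: field_simps)
    thus "y = (P1, Q1)"
      by (simp add: y_eq t s P1_def Q1_def)
  qed
qed

definition rf_quot :: "'a :: field poly fract \<Rightarrow> 'a poly \<times> 'a poly" where
  "rf_quot f = (THE (P, Q). coprime P Q \<and> lead_coeff Q = 1 \<and> f = Fract P Q)"

definition rf_num :: "'a :: field poly fract \<Rightarrow> 'a poly" where
  "rf_num f = fst (rf_quot f)"

definition rf_den :: "'a :: field poly fract \<Rightarrow> 'a poly" where
  "rf_den f = snd (rf_quot f)"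

lemma rf_num_den:
  shows coprime_rf_num_den: "coprime (rf_num f) (rf_den f)"
    and lead_coeff_rf_den: "lead_coeff (rf_den f) = 1"
    and Fract_rf_num_den: "Fract (rf_num f) (rf_den f) = f"
  using theI'[OF rf_lowest_terms_ex1[of f]]
  by (simp_all add: rf_quot_def rf_num_def rf_den_def case_prod_unfold)

lemma rf_den_nonzero: "rf_den f \<noteq> 0"
  using lead_coeff_rf_den[of f] by auto

definition rf_degree :: "'a :: field poly fract \<Rightarrow> nat" where
  "rf_degree f = max (degree (rf_num f)) (degree (rf_den f))"

text \<open>
  \<open>g(h(X))\<close>, computed in the field \<open>K(X)\<close>. For nonconstant \<open>h\<close> the denominator is nonzero.
\<close>

definition rf_compose :: "'a :: field poly fract \<Rightarrow> 'a poly fract \<Rightarrow> 'a poly fract" where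
  "rf_compose g h =
     poly (map_poly (\<lambda>c. Fract [:c:] 1) (rf_num g)) h /
     poly (map_poly (\<lambda>c. Fract [:c:] 1) (rf_den g)) h"

definition rf_indecomposable :: "'a :: field poly fract \<Rightarrow> bool" where
  "rf_indecomposable f \<longleftrightarrow> rf_degree f \<ge> 2 \<and>
     \<not> (\<exists>g h. rf_degree g \<ge> 2 \<and> rf_degree h \<ge> 2 \<and> f = rf_compose g h)"


section \<open>The projective line\<close>

datatype 'a proj_line = Aff 'a | Infinity

text \<open>The point with homogeneous coordinates \<open>(x : y)\<close>.\<close>

definition proj_point :: "'a :: field \<Rightarrow> 'a \<Rightarrow> 'a proj_line" where
  "proj_point x y = (if y = 0 then Infinity else Aff (x / y))"

text \<open>
  At \<open>\<infinity> = (1 : 0)\<close>, evaluating the degree-\<open>rf_degree f\<close> homogenizations of numerator and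
  denominator gives the coefficients used below.
\<close>

fun rf_eval :: "'a :: field poly fract \<Rightarrow> 'a proj_line \<Rightarrow> 'a proj_line" where
  "rf_eval f (Aff c) = proj_point (poly (rf_num f) c) (poly (rf_den f) c)"
| "rf_eval f Infinity =
     proj_point (coeff (rf_num f) (rf_degree f)) (coeff (rf_den f) (rf_degree f))"


text \<open>The base change of \<open>f\<close> to a rational function over the algebraic closure.\<close>

definition rf_to_ac :: "'a :: field poly fract \<Rightarrow> 'a alg_closure poly fract" where
  "rf_to_ac f = Fract (map_poly to_ac (rf_num f)) (map_poly to_ac (rf_den f))"

lemma rf_to_ac_Fract:
  assumes "Q \<noteq> 0"
  shows "rf_to_ac (Fract P Q) = Fract (map_poly to_ac P) (map_poly to_ac Q)"
proof -
  have mp: "map_poly to_ac (A * B) = map_poly to_ac A * map_poly to_ac B" for A B :: "'a poly"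
    by (rule poly_eqI) (simp add: coeff_map_poly coeff_mult to_ac_sum)
  have nz: "map_poly to_ac A \<noteq> 0" if "A \<noteq> 0" for A :: "'a poly"
    using that by (simp add: map_poly_eq_0_iff)
  have "rf_num (Fract P Q) * Q = P * rf_den (Fract P Q)"
    using Fract_rf_num_den[of "Fract P Q"] rf_den_nonzero[of "Fract P Q"] assms
    by (simp add: eq_fract)
  hence "map_poly to_ac (rf_num (Fract P Q)) * map_poly to_ac Q =
         map_poly to_ac P * map_poly to_ac (rf_den (Fract P Q))"
    by (metis mp)
  thus ?thesis
    unfolding rf_to_ac_def using nz[OF assms] nz[OF rf_den_nonzero, of "Fract P Q"]
    by (simp add: eq_fract)
qed


section \<open>Finite fields inside an algebraic closure\<close>

text \<open>
  With \<open>q = CARD('a)\<close>, this is the copy of \<open>\<bbbF>\<^bsub>q^n\<^esub>\<close> in the algebraic closure of \<open>\<bbbF>\<^sub>q = 'a\<close>;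
  the lemmas below show, for \<open>n > 0\<close>, that it is the unique subfield with \<open>q ^ n\<close> elements.
\<close>

definition ext_field :: "nat \<Rightarrow> 'a :: finite_field alg_closure set" where
  "ext_field n = {x. x ^ (CARD('a) ^ n) = x}"

lemma of_nat_CARD_finite_field: "(of_nat CARD('a) :: 'a :: finite_field) = 0"
proof -
  have "(\<Sum>x\<in>(UNIV :: 'a set). x) = (\<Sum>x\<in>UNIV. x + 1)"
    by (rule sum.reindex_bij_witness[of _ "\<lambda>x. x + 1" "\<lambda>x. x - 1"]) auto
  thus ?thesis by (simp add: sum.distrib)
qed

lemma poly_add_power_eq:
  fixes c d x :: "'b :: field" and A :: "'b set"
  assumes A: "card A = q" "finite A" "q > 0"
    and roots: "\<And>x. x \<in> A \<Longrightarrow> (x + c) ^ q = x ^ q + d"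
  shows "(x + c) ^ q = x ^ q + d"
proof -
  define p where "p = [:c, 1:] ^ q - monom 1 q - [:d:]"
  have ev: "poly p x = (x + c) ^ q - x ^ q - d" for x
    by (simp add: p_def poly_monom algebra_simps)
  have "p = 0"
  proof (rule ccontr)
    assume p: "p \<noteq> 0"
    have "q \<le> card {x. poly p x = 0}"
      unfolding A(1)[symmetric]
      by (rule card_mono) (use roots poly_roots_finite[OF p] in \<open>auto simp: ev\<close>)
    also have "\<dots> \<le> degree p" by (rule card_poly_roots_bound[OF p])
    finally have "q \<le> degree p" .
    moreover have "degree p < q"
    proof -
      have deg: "degree ([:c, 1:] ^ q) = q" by (simp add: degree_linear_power)
      have "lead_coeff ([:c, 1:] ^ q) = 1" by (simp only: lead_coeff_power) simp
      hence top: "coeff ([:c, 1:] ^ q) q = 1" by (simp only: deg)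
      have "coeff p i = 0" if "i \<ge> q" for i
      proof (cases "i = q")
        case True
        thus ?thesis using top A(3) by (simp add: p_def coeff_pCons split: nat.splits)
      next
        case False
        thus ?thesis using that A(3) coeff_eq_0[of "[:c, 1:] ^ q" i]
          by (simp add: p_def deg coeff_pCons split: nat.splits)
      qed
      with p A(3) show ?thesis by (meson leading_coeff_neq_0 not_le)
    qed
    ultimately show False by simp
  qed
  with ev[of x] show ?thesis by (simp add: algebra_simps)
qed

lemma to_ac_power_CARD:
  "to_ac (x :: 'a :: finite_field) ^ CARD('a) = to_ac x"
  by (simp flip: to_ac_power add: finite_field_power_card_eq_same)

lemma alg_closure_add_power_CARD:
  fixes x y :: "'a :: finite_field alg_closure"
  shows "(x + y) ^ CARD('a) = x ^ CARD('a) + y ^ CARD('a)"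
proof -
  have A: "card (range (to_ac :: 'a \<Rightarrow> _)) = CARD('a)"
    by (rule card_image[OF inj_to_ac])
  have 1: "(z + to_ac c) ^ CARD('a) = z ^ CARD('a) + to_ac c ^ CARD('a)" for z and c :: 'a
    by (rule poly_add_power_eq[OF A])
       (auto simp flip: to_ac_add simp: to_ac_power_CARD)
  show ?thesis
    by (rule poly_add_power_eq[OF A])
       (use 1 in \<open>auto simp: add.commute\<close>)
qed

lemma alg_closure_add_power_CARD_power:
  fixes x y :: "'a :: finite_field alg_closure"
  shows "(x + y) ^ (CARD('a) ^ n) = x ^ (CARD('a) ^ n) + y ^ (CARD('a) ^ n)"
  by (induction n arbitrary: x y) (simp_all add: power_mult alg_closure_add_power_CARD)

lemma ext_field_subfield:
  fixes x y :: "'a :: finite_field alg_closure"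
  shows "0 \<in> (ext_field n :: 'a alg_closure set)"
    and "1 \<in> (ext_field n :: 'a alg_closure set)"
    and "x \<in> ext_field n \<Longrightarrow> y \<in> ext_field n \<Longrightarrow> x + y \<in> ext_field n"
    and "x \<in> ext_field n \<Longrightarrow> - x \<in> ext_field n"
    and "x \<in> ext_field n \<Longrightarrow> y \<in> ext_field n \<Longrightarrow> x * y \<in> ext_field n"
    and "x \<in> ext_field n \<Longrightarrow> inverse x \<in> ext_field n"
    and "to_ac c \<in> (ext_field n :: 'a alg_closure set)"
proof -
  show "0 \<in> (ext_field n :: 'a alg_closure set)" by (simp add: ext_field_def)
  show "x \<in> ext_field n \<Longrightarrow> - x \<in> ext_field n"
    using alg_closure_add_power_CARD_power[of x "-x" n]
    by (simp add: ext_field_def eq_neg_iff_add_eq_0 add.commute power_0_left)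
  show "to_ac c \<in> (ext_field n :: 'a alg_closure set)"
    by (simp add: ext_field_def finite_field_power_card_power_eq_same flip: to_ac_power)
qed (auto simp: ext_field_def alg_closure_add_power_CARD_power power_mult_distrib power_inverse)

lemma card_ext_field:
  assumes "n > 0"
  shows "card (ext_field n :: 'a :: finite_field alg_closure set) = CARD('a) ^ n"
proof -
  define N where "N = CARD('a) ^ n"
  have "CARD('a) > 1"
    using card_mono[of UNIV "{0, 1 :: 'a}"] by simp
  hence N: "N > 1" unfolding N_def using assms by (rule one_less_power)
  have "(of_nat CARD('a) :: 'a alg_closure) = 0"
    using of_nat_CARD_finite_field[where ?'a = 'a] by (metis to_ac_0 to_ac_of_nat)
  hence N0: "(of_nat N :: 'a alg_closure) = 0"
    using assms by (simp add: N_def)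
  define p where "p = monom 1 N - [:0, 1 :: 'a alg_closure:]"
  have ev: "poly p x = x ^ N - x" for x by (simp add: p_def poly_monom)
  have deg: "degree p = N"
    using N unfolding p_def by (subst diff_conv_add_uminus, subst degree_add_eq_left)
      (auto simp: degree_monom_eq)
  have p: "p \<noteq> 0" using deg N by auto
  have dp: "pderiv p = - 1"
    by (simp add: p_def pderiv_diff pderiv_monom N0 pderiv_pCons one_pCons)
  have ord: "order x p \<le> 1" for x
  proof (rule ccontr)
    assume "\<not> order x p \<le> 1"
    hence "[:-x, 1:] ^ 2 dvd p"
      by (intro dvd_trans[OF le_imp_power_dvd order_1]) simp
    then obtain r where "p = [:-x, 1:] ^ 2 * r" by (elim dvdE)
    hence "p = [:-x, 1:] * ([:-x, 1:] * r)" by (simp only: power2_eq_square mult.assoc)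
    hence "poly (pderiv p) x = 0" by (simp only: pderiv_mult poly_add poly_mult) simp
    thus False by (simp add: dp)
  qed
  obtain A where A: "size A = N" "p = smult (lead_coeff p) (\<Prod>x\<in>#A. [:-x, 1:])"
    using alg_closed_imp_factorization[OF p] unfolding deg by blast
  have "proots p = A"
  proof -
    have "proots p = proots (\<Prod>x\<in>#A. [:-x, 1:])"
      using arg_cong[OF A(2), of proots] p by (simp only: proots_smult leading_coeff_neq_0 not_False_eq_True)
    also have "\<dots> = A"
    proof (induction A)
      case (add x A)
      have "(\<Prod>x\<in>#A. [:-x, 1:]) \<noteq> 0" by auto
      hence "proots ([:-x, 1:] * (\<Prod>x\<in>#A. [:-x, 1:])) = add_mset x A"
        using add.IH by (subst proots_mult) simp_all
      thus ?case by (simp only: image_mset_add_mset prod_mset.add_mset)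
    qed simp
    finally show ?thesis .
  qed
  have cnt: "count A x = 1" if "x \<in># A" for x
  proof -
    have "count A x = order x p" unfolding \<open>proots p = A\<close>[symmetric] by (rule count_proots[OF p])
    moreover have "count A x > 0" using that by simp
    ultimately show ?thesis using ord[of x] by linarith
  qed
  have "card (set_mset A) = size A"
    by (simp add: size_multiset_overloaded_eq cnt)
  moreover have "set_mset A = {x. poly p x = 0}"
    unfolding \<open>proots p = A\<close>[symmetric] by (rule set_count_proots[OF p])
  ultimately show ?thesis
    by (simp add: A(1) ev ext_field_def N_def)
qed

lemma ext_field_unique:
  fixes K :: "'a :: finite_field alg_closure set"
  assumes n: "n > 0" and card: "card K = CARD('a) ^ n"
    and mult: "\<And>x y. x \<in> K \<Longrightarrow> y \<in> K \<Longrightarrow> x * y \<in> K"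
    and zero: "0 \<in> K"
  shows "K = ext_field n"
proof -
  have pos: "CARD('a) ^ n > 0" by simp
  have fin: "finite K" using card pos by (intro card_ge_0_finite) simp
  have finE: "finite (ext_field n :: 'a alg_closure set)"
    using card_ext_field[OF n, where ?'a = 'a] pos by (intro card_ge_0_finite) simp
  have "x \<in> ext_field n" if x: "x \<in> K" for x
  proof (cases "x = 0")
    case True
    thus ?thesis by (simp add: ext_field_subfield(1))
  next
    case False
    have inj: "inj_on ((*) x) (K - {0})"
      using False by (intro inj_onI) simp
    have "(*) x ` (K - {0}) \<subseteq> K - {0}"
      using False mult[OF x] by auto
    hence img: "(*) x ` (K - {0}) = K - {0}"
      using fin card_image[OF inj] by (intro card_subset_eq) simp_all
    have "\<Prod>(K - {0}) = \<Prod>((*) x ` (K - {0}))"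
      by (simp only: img)
    also have "\<dots> = (\<Prod>y\<in>K - {0}. x * y)"
      by (subst prod.reindex[OF inj]) simp
    also have "\<dots> = x ^ card (K - {0}) * \<Prod>(K - {0})"
      by (simp only: prod.distrib prod_constant)
    finally have "\<Prod>(K - {0}) = x ^ card (K - {0}) * \<Prod>(K - {0})" .
    moreover have "\<Prod>(K - {0}) \<noteq> 0"
      using fin by simp
    ultimately have "x ^ card (K - {0}) = 1"
      by (metis mult_cancel_right1)
    hence "x ^ Suc (card (K - {0})) = x"
      by (simp only: power_Suc mult_1_right)
    moreover have "Suc (card (K - {0})) = CARD('a) ^ n"
      using fin zero card by (metis card_Suc_Diff1)
    ultimately show ?thesis
      by (simp only: ext_field_def mem_Collect_eq)
  qed
  hence "K \<subseteq> ext_field n" by (rule subsetI)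
  thus ?thesis
    by (rule card_subset_eq[OF finE]) (simp only: card card_ext_field[OF n])
qed

definition proj_line_ext :: "nat \<Rightarrow> 'a :: finite_field alg_closure proj_line set" where
  "proj_line_ext n = insert Infinity (Aff ` ext_field n)"

definition rf_permutes_ext :: "'a :: finite_field poly fract \<Rightarrow> nat \<Rightarrow> bool" where
  "rf_permutes_ext f n \<longleftrightarrow>
     bij_betw (rf_eval (rf_to_ac f)) (proj_line_ext n) (proj_line_ext n)"

definition rf_exceptional :: "'a :: finite_field poly fract \<Rightarrow> bool" where
  "rf_exceptional f \<longleftrightarrow> infinite {n. n > 0 \<and> rf_permutes_ext f n}"


section \<open>Dickson polynomials of the second kind\<close>

definition dickson2 :: "nat \<Rightarrow> 'a :: comm_ring_1 \<Rightarrow> 'a poly" where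
  "dickson2 r a =
     (\<Sum>i\<le>r div 2. monom (of_nat ((r - i) choose i) * (- a) ^ i) (r - 2 * i))"

end

theory Submission
  imports Defs
begin

text \<open>
  Write \<open>D = X\<^sup>2 - 4a\<close>. In characteristic \<open>p\<close> one has \<open>2 E\<^sub>r = X D\<^bsup>(r-1)/2\<^esup> + X\<^sup>r\<close>, so \<open>E\<^sub>r\<close> is squarefree and
  prime to \<open>D\<close>: all zeros of \<open>f\<close> have multiplicity \<open>(r+1)/2\<close>, and its poles are \<open>\<plusminus>2\<surd>a\<close>, of order
  \<open>r(r-1)/4\<close>, and infinity, of order \<open>r\<close>. If \<open>f = g \<circ> h\<close>, normalise \<open>g\<close> and \<open>h\<close> to fix infinity and ask which
  of \<open>\<plusminus>2\<surd>a\<close> are poles of \<open>h\<close>. If neither, degrees and derivatives give a contradiction; if exactly one,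
  divisibility of the pole orders forces \<open>r = 9\<close>, and Frobenius, which swaps \<open>\<plusminus>2\<surd>a\<close>, excludes this over
  \<open>F\<^sub>q\<close>; if both, \<open>g\<close> is a polynomial and a Riemann-Hurwitz count for \<open>h\<close> leaves at most three distinct
  roots of \<open>g\<close>, which is too few.

  For the permutation property, the substitution \<open>c = \<surd>a (y + 1/y)\<close>, \<open>y = v\<^bsup>(r-1)/2\<^esup>\<close> identifies \<open>f\<^sup>2\<close> with the
  quotient map of the projective \<open>v\<close>-line by \<open>PGL\<^sub>2(F\<^sub>r)\<close>. Hence equal values come from \<open>w = M v\<close> with \<open>M\<close> in
  \<open>PGL\<^sub>2(F\<^sub>r)\<close>. Frobenius acts on \<open>v\<close> and \<open>w\<close> through monomial matrices of nonsquare determinant, and the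
  condition on 2-adic valuations then forces \<open>M\<close> to be monomial, that is, \<open>c' = \<plusminus>c\<close>;
  since \<open>f\<close> is odd and vanishes on \<open>F\<^sub>Q\<close>, \<open>Q = q\<^sup>n\<close>, only at 0, \<open>c' = c\<close>.
\<close>

section \<open>Binary forms\<close>

lemma poly_bezout:
  fixes P Q :: "'a :: field poly"
  shows "\<exists>u v. u * P + v * Q dvd P \<and> u * P + v * Q dvd Q"
proof (induction "if Q = 0 then 0 else Suc (degree Q)" arbitrary: P Q rule: less_induct)
  case less
  show ?case
  proof (cases "Q = 0")
    case True
    show ?thesis by (rule exI[of _ 1], rule exI[of _ 0]) (simp add: True)
  next
    case False
    have "\<exists>u v. u * Q + v * (P mod Q) dvd Q \<and> u * Q + v * (P mod Q) dvd P mod Q"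
      by (rule less) (use False degree_mod_less[OF False, of P] in auto)
    then obtain u v where uv: "u * Q + v * (P mod Q) dvd Q" "u * Q + v * (P mod Q) dvd P mod Q"
      by blast
    have m: "P mod Q = P - P div Q * Q" by (simp add: minus_div_mult_eq_mod)
    have e: "u * Q + v * (P mod Q) = v * P + (u - v * (P div Q)) * Q"
      unfolding m by (simp add: algebra_simps)
    have "u * Q + v * (P mod Q) dvd P"
      using uv by (metis dvd_mod_imp_dvd)
    with uv(1) show ?thesis unfolding e by blast
  qed
qed

lemma coprime_imp_bezout:
  fixes P Q :: "'a :: field poly"
  assumes "coprime P Q"
  obtains u v where "u * P + v * Q = 1"
proof -
  obtain u v where uv: "u * P + v * Q dvd P" "u * P + v * Q dvd Q"
    using poly_bezout by blast
  hence "u * P + v * Q dvd 1" using assms by (rule coprime_common_divisor[rotated])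
  then obtain t where "1 = (u * P + v * Q) * t" by (elim dvdE)
  hence "(t * u) * P + (t * v) * Q = 1" by (simp add: algebra_simps)
  thus ?thesis by (rule that)
qed

lemma coprime_no_common_root:
  fixes P Q :: "'a :: field poly"
  assumes "coprime P Q" "poly P x = 0" "poly Q x = 0"
  shows False
proof -
  obtain u v where "u * P + v * Q = 1" using coprime_imp_bezout assms(1) by blast
  from arg_cong[OF this, of "\<lambda>p. poly p x"] show False using assms by simp
qed

lemma coprimeI_no_common_root:
  fixes P Q :: "'a :: alg_closed_field poly"
  assumes "\<And>x. poly P x = 0 \<Longrightarrow> poly Q x = 0 \<Longrightarrow> False"
  shows "coprime P Q"
proof (rule coprimeI)
  fix t assume t: "t dvd P" "t dvd Q"
  have nr: "poly t x \<noteq> 0" for x using t assms by (metis dvd_trans poly_eq_0_iff_dvd)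
  hence "t \<noteq> 0" by force
  moreover have "degree t = 0" using nr alg_closed_imp_poly_has_root by blast
  ultimately show "is_unit t" by (simp add: is_unit_iff_degree)
qed

lemma map_poly_to_ac_mult: "map_poly to_ac (A * B) = map_poly to_ac A * map_poly to_ac B"
  by (rule poly_eqI) (simp add: coeff_map_poly coeff_mult to_ac_sum)

lemma map_poly_to_ac_add: "map_poly to_ac (A + B) = map_poly to_ac A + map_poly to_ac B"
  by (rule poly_eqI) (simp add: coeff_map_poly)

lemma map_poly_to_ac_diff: "map_poly to_ac (A - B) = map_poly to_ac A - map_poly to_ac B"
  by (rule poly_eqI) (simp add: coeff_map_poly)

lemma map_poly_to_ac_smult: "map_poly to_ac (smult c A) = smult (to_ac c) (map_poly to_ac A)"
  by (rule poly_eqI) (simp add: coeff_map_poly)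

lemma map_poly_to_ac_power: "map_poly to_ac (A ^ n) = map_poly to_ac A ^ n"
  by (induction n) (simp_all add: map_poly_to_ac_mult map_poly_1')

lemma map_poly_to_ac_sum: "map_poly to_ac (sum F I) = (\<Sum>i\<in>I. map_poly to_ac (F i))"
  by (induction I rule: infinite_finite_induct) (simp_all add: map_poly_to_ac_add)

lemma degree_map_poly_to_ac: "degree (map_poly to_ac A) = degree A"
  by (rule degree_map_poly) simp

lemma coprime_map_poly_to_ac:
  fixes P Q :: "'a :: field poly"
  assumes "coprime P Q"
  shows "coprime (map_poly to_ac P) (map_poly to_ac Q)"
proof -
  obtain u v where "u * P + v * Q = 1" using coprime_imp_bezout assms by blast
  from arg_cong[OF this, of "map_poly to_ac"]
  have e: "map_poly to_ac u * map_poly to_ac P + map_poly to_ac v * map_poly to_ac Q = 1"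
    by (simp add: map_poly_to_ac_mult map_poly_to_ac_add)
  show ?thesis
  proof (rule coprimeI)
    fix t assume "t dvd map_poly to_ac P" "t dvd map_poly to_ac Q"
    hence "t dvd map_poly to_ac u * map_poly to_ac P + map_poly to_ac v * map_poly to_ac Q"
      by (intro dvd_add dvd_mult)
    thus "is_unit t" by (simp add: e)
  qed
qed

lemma rf_num_den_Fract:
  fixes P Q :: "'a :: field poly"
  assumes "coprime P Q" "lead_coeff Q = 1"
  shows rf_num_Fract: "rf_num (Fract P Q) = P" and rf_den_Fract: "rf_den (Fract P Q) = Q"
proof -
  have "rf_quot (Fract P Q) = (P, Q)"
    unfolding rf_quot_def by (rule the1_equality[OF rf_lowest_terms_ex1]) (use assms in simp)
  thus "rf_num (Fract P Q) = P" "rf_den (Fract P Q) = Q"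
    by (simp_all add: rf_num_def rf_den_def)
qed

lemma coprime_Fract_eqE:
  fixes P Q P' Q' :: "'a :: field poly"
  assumes "coprime P Q" "Q \<noteq> 0" "coprime P' Q'" "Q' \<noteq> 0" "P * Q' = P' * Q"
  obtains c where "c \<noteq> 0" "P = smult c P'" "Q = smult c Q'"
proof -
  define c where "c = lead_coeff Q"
  define c' where "c' = lead_coeff Q'"
  have c: "c \<noteq> 0" "c' \<noteq> 0" using assms by (auto simp: c_def c'_def)
  define N where "N = (\<lambda>t (A :: 'a poly). smult (inverse t) A)"
  have cop: "coprime (N t A) (N t B)" if "coprime A B" "t \<noteq> 0" for A B t
  proof (rule coprimeI)
    fix w assume "w dvd N t A" "w dvd N t B"
    hence "w dvd A" "w dvd B" using that(2) by (auto simp: N_def dvd_smult_iff)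
    thus "is_unit w" using that(1) by (rule coprime_common_divisor[rotated])
  qed
  have "Fract (N c P) (N c Q) = Fract (N c' P') (N c' Q')"
    using assms c by (simp add: eq_fract N_def mult.commute)
  moreover have "lead_coeff (N c Q) = 1" "lead_coeff (N c' Q') = 1"
    using c by (simp_all add: N_def c_def c'_def)
  ultimately have "N c P = N c' P'" "N c Q = N c' Q'"
    using rf_num_den_Fract[OF cop[OF assms(1) c(1)]] rf_num_den_Fract[OF cop[OF assms(3) c(2)]]
    by simp_all
  moreover have "A = smult c (N c A)" "smult c (N c' A) = smult (c / c') A" for A
    using c by (simp_all add: N_def divide_inverse)
  ultimately have "P = smult (c / c') P'" "Q = smult (c / c') Q'" by metis+
  thus ?thesis using c by (intro that[of "c / c'"]) auto
qed

definition homog :: "nat \<Rightarrow> 'a :: comm_ring_1 poly \<Rightarrow> 'a poly \<Rightarrow> 'a poly \<Rightarrow> 'a poly" where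
  "homog m G U V = (\<Sum>i\<le>m. smult (coeff G i) (U ^ i * V ^ (m - i)))"

lemma poly_homog:
  "poly (homog m G U V) x = (\<Sum>i\<le>m. coeff G i * (poly U x ^ i * poly V x ^ (m - i)))"
  by (simp add: homog_def poly_sum)

lemma homog_eq_poly_divide:
  fixes G :: "'a :: field poly"
  assumes "degree G \<le> m" "v \<noteq> 0"
  shows "(\<Sum>i\<le>m. coeff G i * (u ^ i * v ^ (m - i))) = v ^ m * poly G (u / v)"
proof -
  have "poly G (u / v) = (\<Sum>i\<le>m. coeff G i * (u / v) ^ i)"
    unfolding poly_altdef
    by (rule sum.mono_neutral_left) (use assms in \<open>auto simp: coeff_eq_0\<close>)
  hence "v ^ m * poly G (u / v) = (\<Sum>i\<le>m. v ^ m * (coeff G i * (u / v) ^ i))"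
    by (simp add: sum_distrib_left)
  also have "\<dots> = (\<Sum>i\<le>m. coeff G i * (u ^ i * v ^ (m - i)))"
  proof (rule sum.cong)
    fix i assume "i \<in> {..m}"
    hence 1: "v ^ m = v ^ (m - i) * v ^ i" by (simp flip: power_add)
    have 2: "v ^ i * (u / v) ^ i = u ^ i"
      using assms(2) by (simp flip: power_mult_distrib)
    have "v ^ m * (coeff G i * (u / v) ^ i) = coeff G i * ((v ^ i * (u / v) ^ i) * v ^ (m - i))"
      unfolding 1 by (simp only: mult_ac)
    thus "v ^ m * (coeff G i * (u / v) ^ i) = coeff G i * (u ^ i * v ^ (m - i))"
      unfolding 2 .
  qed simp
  finally show ?thesis by simp
qed

lemma homog_common_root:
  fixes G1 G2 :: "'a :: field poly"
  assumes cop: "coprime G1 G2" and m: "m = max (degree G1) (degree G2)"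
    and z: "poly (homog m G1 U V) x = 0" "poly (homog m G2 U V) x = 0"
  shows "poly U x = 0 \<and> poly V x = 0"
proof (cases "poly V x = 0")
  case False
  have "poly G1 (poly U x / poly V x) = 0" "poly G2 (poly U x / poly V x) = 0"
    using z False m by (simp_all add: poly_homog homog_eq_poly_divide)
  thus ?thesis using coprime_no_common_root[OF cop] by blast
next
  case True
  have *: "poly (homog m G U V) x = coeff G m * poly U x ^ m" for G
  proof -
    have "poly (homog m G U V) x = (\<Sum>i\<in>{m}. coeff G i * (poly U x ^ i * poly V x ^ (m - i)))"
      unfolding poly_homog by (rule sum.mono_neutral_right) (auto simp: True)
    thus ?thesis by simp
  qed
  have "G1 \<noteq> 0 \<or> G2 \<noteq> 0" using cop by auto
  hence "coeff G1 m \<noteq> 0 \<or> coeff G2 m \<noteq> 0" using m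
    by (metis degree_0 leading_coeff_neq_0 max_0L max_0R max_def)
  with * z True show ?thesis by (cases "m = 0") auto
qed

lemma homog_root_factor:
  "homog (Suc m) ([:-y, 1:] * G) U V = (U - smult y V) * homog m G U V" if "degree G \<le> m"
proof -
  have c: "coeff ([:-y, 1:] * G) i = (case i of 0 \<Rightarrow> 0 | Suc j \<Rightarrow> coeff G j) - y * coeff G i" for i
    by (simp add: coeff_pCons split: nat.splits)
  have "homog (Suc m) ([:-y, 1:] * G) U V =
      (\<Sum>i\<le>Suc m. smult (case i of 0 \<Rightarrow> 0 | Suc j \<Rightarrow> coeff G j) (U ^ i * V ^ (Suc m - i)))
      - (\<Sum>i\<le>Suc m. smult (y * coeff G i) (U ^ i * V ^ (Suc m - i)))"
    unfolding homog_def c by (simp only: smult_diff_left sum_subtractf)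
  also have "(\<Sum>i\<le>Suc m. smult (case i of 0 \<Rightarrow> 0 | Suc j \<Rightarrow> coeff G j) (U ^ i * V ^ (Suc m - i)))
      = U * homog m G U V"
    by (simp add: sum.atMost_Suc_shift homog_def sum_distrib_left algebra_simps del: sum.atMost_Suc)
  also have "(\<Sum>i\<le>Suc m. smult (y * coeff G i) (U ^ i * V ^ (Suc m - i)))
      = (\<Sum>i\<le>m. smult (y * coeff G i) (U ^ i * V ^ (Suc m - i)))"
    using that by (simp add: coeff_eq_0)
  also have "\<dots> = smult y V * homog m G U V"
    unfolding homog_def sum_distrib_left
    by (rule sum.cong) (auto simp: Suc_diff_le algebra_simps)
  finally show ?thesis by (simp add: algebra_simps)
qed

lemma homog_Suc:
  "homog (Suc m) G U V = V * homog m G U V" if "degree G \<le> m"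
proof -
  have "homog (Suc m) G U V = (\<Sum>i\<le>m. smult (coeff G i) (U ^ i * V ^ (Suc m - i)))"
    using that by (simp add: homog_def coeff_eq_0)
  also have "\<dots> = V * homog m G U V"
    unfolding homog_def sum_distrib_left
    by (rule sum.cong) (auto simp: Suc_diff_le algebra_simps)
  finally show ?thesis .
qed

definition linear_forms_prod :: "'a :: comm_ring_1 poly \<Rightarrow> 'a poly \<Rightarrow> ('a \<times> 'a) multiset \<Rightarrow> 'a poly" where
  "linear_forms_prod U V L = (\<Prod>(s, t)\<in>#L. smult s U + smult t V)"

lemma homog_split:
  fixes G :: "'a :: alg_closed_field poly"
  assumes "G \<noteq> 0" "degree G \<le> m"
  shows "\<exists>c L. c \<noteq> 0 \<and> size L = m \<and> (0, 0) \<notin># L \<and>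
           (\<forall>U V. homog m G U V = smult c (linear_forms_prod U V L))"
  using assms
proof (induction m arbitrary: G)
  case 0
  hence "degree G = 0" by simp
  then obtain c where "G = [:c:]" by (rule degree_eq_zeroE)
  moreover from this 0 have "c \<noteq> 0" by simp
  ultimately show ?case
    by (intro exI[of _ c] exI[of _ "{#}"]) (simp add: homog_def linear_forms_prod_def)
next
  case (Suc m)
  show ?case
  proof (cases "degree G \<le> m")
    case True
    then obtain c L where "c \<noteq> 0" "size L = m" "(0, 0) \<notin># L"
      "\<And>U V. homog m G U V = smult c (linear_forms_prod U V L)"
      using Suc by blast
    thus ?thesis
      by (intro exI[of _ c] exI[of _ "add_mset (0, 1) L"])
         (simp add: homog_Suc[OF True] linear_forms_prod_def)
  next
    case False
    hence "degree G > 0" by simp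
    then obtain y where "poly G y = 0" using alg_closed_imp_poly_has_root by blast
    then obtain G' where G': "G = [:-y, 1:] * G'" by (metis dvdE poly_eq_0_iff_dvd)
    have nz: "G' \<noteq> 0" using Suc.prems G' by auto
    hence deg: "degree G' \<le> m" using Suc.prems(2) unfolding G'
      by (subst (asm) degree_mult_eq) auto
    obtain c L where "c \<noteq> 0" "size L = m" "(0, 0) \<notin># L"
      "\<And>U V. homog m G' U V = smult c (linear_forms_prod U V L)"
      using Suc.IH[OF nz deg] by blast
    thus ?thesis
      by (intro exI[of _ c] exI[of _ "add_mset (1, -y) L"])
         (simp add: G' homog_root_factor[OF deg] linear_forms_prod_def del: mult_pCons_left)
  qed
qed

lemma linear_forms_prod_normal:
  fixes U V :: "'a :: field poly"
  assumes "(0, 0) \<notin># L"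
  shows "\<exists>c A. c \<noteq> 0 \<and> size A \<le> size L \<and> (size A < size L \<longrightarrow> (\<exists>t. (0, t) \<in># L)) \<and>
    linear_forms_prod U V L =
      smult c ((\<Prod>y\<in>#A. U - smult y V) * V ^ (size L - size A))"
  using assms
proof (induction L)
  case empty
  show ?case by (intro exI[of _ 1] exI[of _ "{#}"]) (simp add: linear_forms_prod_def)
next
  case (add l L)
  obtain s t where l: "l = (s, t)" by (cases l)
  obtain c A where A: "c \<noteq> 0" "size A \<le> size L" "size A < size L \<longrightarrow> (\<exists>t. (0, t) \<in># L)"
    "linear_forms_prod U V L = smult c ((\<Prod>y\<in>#A. U - smult y V) * V ^ (size L - size A))"
    using add by auto
  have e: "linear_forms_prod U V (add_mset l L) = (smult s U + smult t V) * linear_forms_prod U V L"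
    by (simp add: linear_forms_prod_def l)
  show ?case
  proof (cases "s = 0")
    case True
    hence "t \<noteq> 0" using add.prems l by auto
    thus ?thesis unfolding e using A True l
      by (intro exI[of _ "c * t"] exI[of _ A]) (auto simp: Suc_diff_le algebra_simps)
  next
    case False
    have "smult s U + smult t V = smult s (U - smult (-t/s) V)" using False by (simp add: smult_add_right)
    thus ?thesis unfolding e using A False
      by (intro exI[of _ "c * s"] exI[of _ "add_mset (-t/s) A"]) (auto simp: algebra_simps)
  qed
qed

lemma linear_forms_prod_change:
  fixes U V H1 H2 :: "'a :: field poly"
  assumes "H1 = smult a U + smult b V" "H2 = smult c U + smult d V" "a * d - b * c \<noteq> 0"
    and "(0, 0) \<notin># L"
  defines "T \<equiv> \<lambda>(s, t). (s * a + t * c, s * b + t * d)"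
  shows "linear_forms_prod H1 H2 L = linear_forms_prod U V (image_mset T L)"
    and "(0, 0) \<notin># image_mset T L"
proof -
  have "smult s H1 + smult t H2 = (case T (s, t) of (s, t) \<Rightarrow> smult s U + smult t V)" for s t
    by (simp add: assms(1,2) T_def algebra_simps smult_add_left smult_add_right)
  thus "linear_forms_prod H1 H2 L = linear_forms_prod U V (image_mset T L)"
    by (simp add: linear_forms_prod_def image_mset.compositionality comp_def case_prod_unfold)
  have "(s, t) = (0, 0)" if "T (s, t) = (0, 0)" for s t
  proof -
    have 1: "s * a + t * c = 0" "s * b + t * d = 0" using that by (auto simp: T_def)
    have "s * (a * d - b * c) = d * (s * a + t * c) - c * (s * b + t * d)"
         "t * (a * d - b * c) = a * (s * b + t * d) - b * (s * a + t * c)"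
      by (simp_all add: algebra_simps)
    thus ?thesis using 1 assms(3) by simp
  qed
  hence "T z = (0, 0) \<Longrightarrow> z = (0, 0)" for z by (cases z) simp
  thus "(0, 0) \<notin># image_mset T L" using assms(4) by (metis (no_types) imageE set_image_mset)
qed

section \<open>Decompositions over an algebraically closed field\<close>

lemma sum_order_eq_degree:
  fixes p :: "'a :: alg_closed_field poly"
  assumes "p \<noteq> 0" "finite S" "{x. poly p x = 0} \<subseteq> S"
  shows "(\<Sum>x\<in>S. order x p) = degree p"
proof -
  obtain A where A: "size A = degree p" "p = smult (lead_coeff p) (\<Prod>x\<in>#A. [:-x, 1:])"
    using alg_closed_imp_factorization[OF assms(1)] by blast
  have pr: "proots (\<Prod>x\<in>#A. [:-x, 1:]) = A"
  proof (induction A)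
    case (add x A)
    have "(\<Prod>x\<in>#A. [:-x, 1:]) \<noteq> 0" by auto
    thus ?case using add
      by (simp only: image_mset_add_mset prod_mset.add_mset, subst proots_mult) auto
  qed simp
  have "proots p = proots (\<Prod>x\<in>#A. [:-x, 1:])"
    using arg_cong[OF A(2), of proots] assms(1)
    by (simp only: proots_smult leading_coeff_neq_0 not_False_eq_True)
  hence "size (proots p) = degree p" using A(1) pr by simp
  hence "degree p = (\<Sum>x | poly p x = 0. order x p)"
    using assms(1) by (simp add: size_multiset_overloaded_eq)
  also have "\<dots> = (\<Sum>x\<in>S. order x p)"
    using assms by (intro sum.mono_neutral_left) (auto simp: order_root)
  finally show ?thesis by simp
qed

lemma order_eq_degree_unique_root:
  fixes p :: "'a :: alg_closed_field poly"
  assumes "p \<noteq> 0" "\<And>y. poly p y = 0 \<Longrightarrow> y = x"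
  shows "order x p = degree p"
  using sum_order_eq_degree[OF assms(1), of "{x}"] assms(2) by auto

lemma unique_root_poly_eq:
  fixes p :: "'a :: alg_closed_field poly"
  assumes "p \<noteq> 0" "\<And>y. poly p y = 0 \<Longrightarrow> y = x"
  shows "p = smult (lead_coeff p) ([:-x, 1:] ^ degree p)"
proof -
  have "[:-x, 1:] ^ degree p dvd p"
    using order_1[of x p] order_eq_degree_unique_root[OF assms] by simp
  then obtain q where q: "p = [:-x, 1:] ^ degree p * q" by (elim dvdE)
  have "q \<noteq> 0" using q assms(1) by auto
  hence "degree p = degree p + degree q"
    using arg_cong[OF q, of degree] by (simp add: degree_mult_eq degree_linear_power)
  then obtain c where c: "q = [:c:]" by (auto elim: degree_eq_zeroE)
  have "lead_coeff p = lead_coeff ([:-x, 1:] ^ degree p) * lead_coeff q"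
    using arg_cong[OF q, of lead_coeff] by (simp only: lead_coeff_mult)
  also have "\<dots> = c" by (simp only: lead_coeff_power c) simp
  finally show ?thesis using q c by simp
qed

lemma linear_power_dvd_pderiv:
  fixes p :: "'a :: field poly"
  assumes "[:-x, 1:] ^ k dvd p"
  shows "[:-x, 1:] ^ (k - 1) dvd pderiv p"
proof (cases k)
  case (Suc j)
  then obtain q where "p = [:-x, 1:] ^ Suc j * q" using assms Suc by (metis dvdE)
  hence "pderiv p = [:-x, 1:] ^ Suc j * pderiv q + smult (of_nat (Suc j)) (q * [:-x, 1:] ^ j)"
    by (simp only: lemma_order_pderiv1)
  moreover have "[:-x, 1:] ^ j dvd \<dots>" by (intro dvd_add dvd_smult dvd_mult dvd_mult2 le_imp_power_dvd) simp_all
  ultimately show ?thesis using Suc by simp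
qed simp

lemma degree_pderiv_le_diff: "degree (pderiv p) \<le> degree p - 1"
  by (rule degree_le) (auto simp: coeff_pderiv intro!: coeff_eq_0)

lemma order_linear_power: "order x ([:-y, 1:] ^ k) = (if x = y then k else 0)"
  by (auto simp: order_power_n_n intro!: order_0I)

lemma order_power: "order x (p ^ k) = k * order x p" if "p \<noteq> 0"
  using that by (induction k) (simp_all add: order_mult)

text \<open>
  Here \<open>r = 4t + 1\<close> and \<open>\<beta> = 2\<surd>a\<close>, so that \<open>f = E\<^bsup>2t+1\<^esup> / (X\<^sup>2 - \<beta>\<^sup>2)\<^bsup>t(4t+1)\<^esup>\<close>.
\<close>

locale dickson_quotient =
  fixes E :: "'a :: alg_closed_field poly" and t :: nat and \<beta> :: 'a
  assumes t: "t \<ge> 2" and beta: "\<beta> \<noteq> - \<beta>"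
    and squarefree: "rsquarefree E" and deg_E: "degree E = 4 * t + 1"
    and separable: "pderiv (E ^ (2 * t + 1)) \<noteq> 0"
    and E_beta: "poly E \<beta> \<noteq> 0" "poly E (- \<beta>) \<noteq> 0"

locale dickson_quotient_decomposition = dickson_quotient E t \<beta>
  for E :: "'a :: alg_closed_field poly" and t :: nat and \<beta> :: 'a +
  fixes U V :: "'a poly" and A B :: "'a multiset" and c c' :: 'a and m n :: nat
  assumes no_common_root: "\<And>x. poly U x = 0 \<Longrightarrow> poly V x = 0 \<Longrightarrow> False"
    and deg_U: "degree U = n" and deg_V: "degree V < n" and n: "n \<ge> 2" and m: "m \<ge> 2"
    and size_le: "size A \<le> m" "size B \<le> m" and size_eq: "size A = m \<or> size B = m"
    and c: "c \<noteq> 0" "c' \<noteq> 0"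
    and num_eq: "E ^ (2 * t + 1) = smult c ((\<Prod>y\<in>#A. U - smult y V) * V ^ (m - size A))"
    and den_eq: "([:-\<beta>, 1:] * [:\<beta>, 1:]) ^ (t * (4 * t + 1)) =
                   smult c' ((\<Prod>y\<in>#B. U - smult y V) * V ^ (m - size B))"
begin

lemma deg_UV: "degree (U - smult y V) = n"
  using deg_U deg_V by (subst diff_conv_add_uminus, subst degree_add_eq_left) auto

lemma UV_nz: "U - smult y V \<noteq> 0"
  using deg_UV[of y] n by auto

lemma V_nz: "V \<noteq> 0"
proof
  assume "V = 0"
  moreover obtain x where "poly U x = 0"
    using alg_closed_imp_poly_has_root[of U] deg_U n by auto
  ultimately show False using no_common_root[of x] by simp
qed

lemma prod_nz: "(\<Prod>y\<in>#M. U - smult y V) \<noteq> 0"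
  using UV_nz by (auto simp: prod_mset_zero_iff)

lemma deg_prod: "degree (\<Prod>y\<in>#M. U - smult y V) = n * size M"
proof (induction M)
  case (add y M)
  thus ?case using degree_mult_eq[OF UV_nz prod_nz, of y M] deg_UV[of y] by simp
qed simp

lemma UV_root: "poly (U - smult y V) x = 0 \<Longrightarrow> poly V x \<noteq> 0"
  using no_common_root[of x] by auto

lemma UV_root_unique: "poly (U - smult y V) x = 0 \<Longrightarrow> poly (U - smult z V) x = 0 \<Longrightarrow> y = z"
  using UV_root[of y x] by auto

lemma order_prod:
  assumes "poly (U - smult y V) x = 0"
  shows "order x (\<Prod>y\<in>#M. U - smult y V) = count M y * order x (U - smult y V)"
proof (induction M)
  case (add z M)
  have "order x (U - smult z V) = 0" if "z \<noteq> y"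
    using UV_root_unique[OF assms, of z] that by (intro order_0I) blast
  moreover have "order x (\<Prod>y\<in>#add_mset z M. U - smult y V) =
      order x (U - smult z V) + order x (\<Prod>y\<in>#M. U - smult y V)"
    using order_mult[of "U - smult z V" "\<Prod>y\<in>#M. U - smult y V" x] UV_nz prod_nz
    by (simp only: image_mset_add_mset prod_mset.add_mset no_zero_divisors not_False_eq_True)
  ultimately show ?case using add by auto
qed simp

lemma order_prod_0: "poly V x = 0 \<Longrightarrow> order x (\<Prod>y\<in>#M. U - smult y V) = 0"
  by (rule order_0I) (use no_common_root[of x] in \<open>auto simp: poly_prod_mset prod_mset_zero_iff image_iff\<close>)

lemma deg_den: "degree (([:-\<beta>, 1:] * [:\<beta>, 1:]) ^ (t * (4 * t + 1))) = 2 * (t * (4 * t + 1))"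
  by (simp add: degree_power_eq)

lemma sizes: "size A = m" "size B < m" "n * m = (4 * t + 1) * (2 * t + 1)"
proof -
  have E: "E \<noteq> 0" using deg_E by auto
  have e: "degree (smult s ((\<Prod>y\<in>#M. U - smult y V) * V ^ (m - size M))) =
        n * size M + (m - size M) * degree V" if "s \<noteq> 0" for s M
    using that degree_mult_eq[OF prod_nz[of M], of "V ^ (m - size M)"]
    by (simp add: V_nz deg_prod degree_power_eq)
  have 1: "(4 * t + 1) * (2 * t + 1) = n * size A + (m - size A) * degree V"
    using arg_cong[OF num_eq, of degree] degree_power_eq[OF E, of "2 * t + 1"]
    unfolding e[OF c(1)] deg_E by (simp only: mult.commute)
  have 2: "2 * (t * (4 * t + 1)) = n * size B + (m - size B) * degree V"
    using arg_cong[OF den_eq, of degree] unfolding deg_den e[OF c(2)] .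
  have "n * size A + (m - size A) * degree V \<le> n * size A + (m - size A) * n"
    using deg_V by simp
  also have "\<dots> = n * m" using size_le(1) by (simp add: algebra_simps flip: add_mult_distrib2)
  finally have 3: "(4 * t + 1) * (2 * t + 1) \<le> n * m" using 1 by simp
  have "size B \<noteq> m"
  proof
    assume "size B = m"
    hence "n * m = 2 * (t * (4 * t + 1))" using 2 by simp
    thus False using 3 by (simp add: algebra_simps)
  qed
  thus "size A = m" "size B < m" "n * m = (4 * t + 1) * (2 * t + 1)"
    using size_eq size_le 1 by auto
qed

lemma num_eq': "E ^ (2 * t + 1) = smult c (\<Prod>y\<in>#A. U - smult y V)"
  using num_eq sizes(1) by simp

lemma den_root: "poly V x = 0 \<or> (\<exists>w. w \<in># B \<and> poly (U - smult w V) x = 0) \<longleftrightarrow> x = \<beta> \<or> x = - \<beta>"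
proof -
  have "t * (4 * t + 1) \<noteq> 0" using t by simp
  hence "x = \<beta> \<or> x = - \<beta> \<longleftrightarrow> poly (([:-\<beta>, 1:] * [:\<beta>, 1:]) ^ (t * (4 * t + 1))) x = 0"
    unfolding poly_power poly_mult power_eq_0_iff mult_eq_0_iff
    by (auto simp: eq_neg_iff_add_eq_0 add.commute)
  also have "\<dots> \<longleftrightarrow> poly V x = 0 \<or> (\<exists>w. w \<in># B \<and> poly (U - smult w V) x = 0)"
    unfolding den_eq using c sizes(2)
    by (auto simp: poly_prod_mset prod_mset_zero_iff image_iff)
  finally show ?thesis by blast
qed

lemma order_den:
  assumes "x = \<beta> \<or> x = - \<beta>"
  shows "order x (\<Prod>y\<in>#B. U - smult y V) + (m - size B) * order x V = t * (4 * t + 1)"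
proof -
  have "order x ([:-\<beta>, 1:] * [:\<beta>, 1:]) = 1"
    using assms beta order_linear_power[of x \<beta> 1] order_linear_power[of x "-\<beta>" 1]
    by (subst order_mult) auto
  hence "order x (([:-\<beta>, 1:] * [:\<beta>, 1:]) ^ (t * (4 * t + 1))) = t * (4 * t + 1)"
    by (subst order_power) auto
  moreover have "order x (smult c' ((\<Prod>y\<in>#B. U - smult y V) * V ^ (m - size B))) =
      order x (\<Prod>y\<in>#B. U - smult y V) + (m - size B) * order x V"
    using c order_mult[OF no_zero_divisors[OF prod_nz[of B]], of "V ^ (m - size B)" x]
    by (simp add: order_smult V_nz order_power)
  ultimately show ?thesis unfolding den_eq by simp
qed

lemma pderiv_UV_nz: "pderiv U \<noteq> 0 \<or> pderiv V \<noteq> 0"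
proof (rule ccontr)
  assume "\<not> ?thesis"
  hence z: "pderiv (U - smult y V) = 0" for y by (simp add: pderiv_diff pderiv_smult)
  have "pderiv (\<Prod>y\<in>#M. U - smult y V) = 0" for M
    by (induction M) (simp_all add: pderiv_mult z)
  hence "pderiv (E ^ (2 * t + 1)) = 0" unfolding num_eq' by (simp add: pderiv_smult)
  thus False using separable by simp
qed

lemma odd_n: "odd n"
proof -
  have "odd (n * m)" unfolding sizes(3) by simp
  thus ?thesis by simp
qed

lemma inner_pole_at_one:
  assumes "poly V \<beta> = 0" "poly V (- \<beta>) \<noteq> 0"
  shows "t = 2"
proof -
  obtain w where w: "w \<in># B" "poly (U - smult w V) (- \<beta>) = 0"
    using den_root[of "- \<beta>"] assms(2) by auto
  have root: "x = - \<beta>" if "z \<in># B" "poly (U - smult z V) x = 0" for x z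
    using den_root[of x] UV_root[OF that(2)] that assms(1) by auto
  have "z = w" if "z \<in># B" for z
  proof -
    obtain x where x: "poly (U - smult z V) x = 0"
      using alg_closed_imp_poly_has_root[of "U - smult z V"] deg_UV[of z] n by auto
    have "poly (U - smult w V) x = 0" unfolding root[OF that x] by (rule w(2))
    thus ?thesis by (rule UV_root_unique[OF x])
  qed
  hence "set_mset B \<subseteq> {w}" by blast
  from arg_cong[OF set_mset_subset_singletonD[OF this], of "\<lambda>M. count M w"]
  have cnt: "count B w = size B" by simp
  have "order (- \<beta>) (U - smult w V) = n"
    using order_eq_degree_unique_root[OF UV_nz, of w "- \<beta>"] root[OF w(1)] deg_UV[of w] by simp
  hence 1: "size B * n = t * (4 * t + 1)"
    using order_den[of "- \<beta>"] order_prod[OF w(2), of B] cnt assms(2) by (simp add: order_0I)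
  have 2: "(m - size B) * order \<beta> V = t * (4 * t + 1)"
    using order_den[of \<beta>] order_prod_0[OF assms(1), of B] by simp
  define \<mu> where "\<mu> = m - size B"
  have "n * \<mu> + size B * n = n * m" using size_le(2)
    by (simp add: \<mu>_def diff_mult_distrib2 mult.commute[of n])
  hence 3: "n * \<mu> = (4 * t + 1) * (t + 1)"
    using 1 sizes(3) by (simp add: algebra_simps)
  have common: "k dvd 4 * t + 1" if "k dvd t * (4 * t + 1)" "k dvd (4 * t + 1) * (t + 1)" for k
  proof -
    have "k dvd (4 * t + 1) * (t + 1) - t * (4 * t + 1)" using that by (rule dvd_diff_nat[rotated])
    thus ?thesis by (simp add: algebra_simps)
  qed
  have "n dvd 4 * t + 1" by (rule common) (metis 1 dvd_triv_right, metis 3 dvd_triv_left)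
  moreover have "\<mu> dvd 4 * t + 1"
    by (rule common) (metis 2 \<mu>_def dvd_triv_left, metis 3 dvd_triv_right)
  ultimately have "n * \<mu> dvd (4 * t + 1) * (4 * t + 1)" by (rule mult_dvd_mono)
  hence "(t + 1) dvd 4 * t + 1" unfolding 3 using t by (simp del: mult_Suc mult_Suc_right)
  moreover have "4 * (t + 1) - (4 * t + 1) = 3" by simp
  ultimately have "(t + 1) dvd 3" by (metis dvd_diff_nat dvd_triv_right)
  hence "t + 1 \<le> 3" by (rule dvd_imp_le) simp
  thus ?thesis using t by simp
qed

lemma inner_pole_at_none:
  assumes "poly V \<beta> \<noteq> 0" "poly V (- \<beta>) \<noteq> 0"
  shows False
proof -
  obtain w where w: "w \<in># B" "poly (U - smult w V) \<beta> = 0"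
    using den_root[of \<beta>] assms by auto
  obtain z where z: "z \<in># B" "poly (U - smult z V) (- \<beta>) = 0"
    using den_root[of "- \<beta>"] assms by auto
  show False
  proof (cases "w = z")
    case True
    have "count B w * order \<beta> (U - smult w V) = t * (4 * t + 1)"
      using order_den[of \<beta>] order_prod[OF w(2), of B] assms by (simp add: order_0I)
    moreover have "count B w * order (- \<beta>) (U - smult w V) = t * (4 * t + 1)"
      using order_den[of "- \<beta>"] order_prod[OF z(2), of B] assms True by (simp add: order_0I)
    moreover have "count B w > 0" using w by simp
    ultimately have "order \<beta> (U - smult w V) = order (- \<beta>) (U - smult w V)"
      by (metis mult_left_cancel neq0_conv)
    moreover have "(\<Sum>x\<in>{\<beta>, - \<beta>}. order x (U - smult w V)) = n"
      by (subst sum_order_eq_degree[OF UV_nz]) (use den_root w deg_UV in auto)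
    ultimately have "2 * order \<beta> (U - smult w V) = n" using beta by simp
    thus False using odd_n by auto
  next
    case False
    have "degree V = 0"
      using alg_closed_imp_poly_has_root[of V] den_root assms by (metis neq0_conv)
    hence dV: "pderiv V = 0" by (metis degree_eq_zeroE pderiv_singleton)
    hence d: "pderiv (U - smult y V) = pderiv U" for y by (simp add: pderiv_diff pderiv_smult)
    have "x = \<beta>" if "poly (U - smult w V) x = 0" for x
      using den_root[of x] that w False z(2) UV_root_unique[OF that, of z] by metis
    hence "U - smult w V = smult (lead_coeff (U - smult w V)) ([:-\<beta>, 1:] ^ n)"
      using unique_root_poly_eq[OF UV_nz, of w "\<beta>"] unfolding deg_UV minus_minus by blast
    then obtain s where s: "U - smult w V = smult s ([:-\<beta>, 1:] ^ n)" by blast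
    have "x = - \<beta>" if "poly (U - smult z V) x = 0" for x
      using den_root[of x] that z False w(2) UV_root_unique[OF that, of w] by metis
    hence "U - smult z V = smult (lead_coeff (U - smult z V)) ([:\<beta>, 1:] ^ n)"
      using unique_root_poly_eq[OF UV_nz, of z "- \<beta>"] unfolding deg_UV minus_minus by blast
    then obtain s' where s': "U - smult z V = smult s' ([:\<beta>, 1:] ^ n)" "s' \<noteq> 0"
      using UV_nz[of z] by (metis smult_0_left)
    have "poly (pderiv U) \<beta> = 0"
      using arg_cong[OF s, of "\<lambda>p. poly (pderiv p) \<beta>"] n
      unfolding d by (simp add: pderiv_smult pderiv_power)
    moreover have dU: "pderiv U = smult s' (smult (of_nat n) ([:\<beta>, 1:] ^ (n - 1)))"
      using arg_cong[OF s'(1), of pderiv]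
      unfolding d by (simp add: pderiv_smult pderiv_power pderiv_pCons)
    ultimately have "of_nat n = (0 :: 'a) \<or> \<beta> + \<beta> = 0"
      using s'(2) by auto
    hence "of_nat n = (0 :: 'a)" using beta by (auto simp: eq_neg_iff_add_eq_0)
    hence "pderiv U = 0" unfolding dU by simp
    thus False using pderiv_UV_nz dV by simp
  qed
qed

text \<open>
  If \<open>V\<close> vanishes at both \<open>\<plusminus>\<beta>\<close>, the outer function is a polynomial of degree \<open>m\<close> dividing \<open>r\<close>. Counting the
  zeros of the Wronskian \<open>U'V - UV'\<close> (a Riemann-Hurwitz count for the inner function \<open>U/V\<close>) bounds
  the number of distinct roots of the outer polynomial.
\<close>

lemma inner_poles_at_both:
  assumes "poly V \<beta> = 0" "poly V (- \<beta>) = 0"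
  shows False
proof -
  have "w \<notin># B" for w
  proof
    assume w: "w \<in># B"
    obtain x where x: "poly (U - smult w V) x = 0"
      using alg_closed_imp_poly_has_root[of "U - smult w V"] deg_UV[of w] n by auto
    hence "x = \<beta> \<or> x = - \<beta>" using den_root[of x] w by blast
    thus False using UV_root[OF x] assms by auto
  qed
  hence B: "B = {#}" by (metis multiset_nonemptyE)
  define j where "j = order \<beta> V"
  have j: "m * order x V = t * (4 * t + 1)" if "x = \<beta> \<or> x = - \<beta>" for x
    using order_den[OF that] B by simp
  hence "m * order (- \<beta>) V = m * j" by (simp add: j_def)
  hence j': "order (- \<beta>) V = j" using m by simp
  have jm: "m * j = t * (4 * t + 1)" using j by (simp add: j_def)
  have "j > 0" using jm t by (cases j) auto
  have "(\<Sum>x\<in>{\<beta>, - \<beta>}. order x V) = degree V"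
    by (rule sum_order_eq_degree[OF V_nz]) (use den_root in auto)
  hence deg_V_eq: "degree V = 2 * j" using beta j' by (simp add: j_def)
  have m_dvd: "m dvd 4 * t + 1"
  proof -
    have "m dvd (4 * t + 1) * (2 * t + 1) - 2 * (t * (4 * t + 1))"
      by (rule dvd_diff_nat) (metis sizes(3) dvd_triv_right, metis jm dvd_mult dvd_triv_left)
    thus ?thesis by (simp add: algebra_simps)
  qed
  then obtain i where i: "4 * t + 1 = m * i" by (elim dvdE)
  have "m * n = m * (i * (2 * t + 1))" using sizes(3) unfolding i by (simp only: ac_simps)
  hence n_eq: "n = i * (2 * t + 1)" using m by simp
  have odd_mi: "odd m" "odd i" by (metis i even_add even_mult_iff even_numeral odd_one)+

  define W where "W = pderiv U * V - U * pderiv V"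
  have W_eq: "W = pderiv (U - smult y V) * V - (U - smult y V) * pderiv V" for y
    by (simp add: W_def pderiv_diff pderiv_smult algebra_simps)
  have W_nz: "W \<noteq> 0"
  proof
    assume "W = 0"
    hence e: "pderiv U * V = U * pderiv V" by (simp add: W_def)
    have "coprime U V" using no_common_root by (intro coprimeI_no_common_root) blast
    then obtain u v where uv: "u * U + v * V = 1" using coprime_imp_bezout by blast
    have "pderiv V = (u * U + v * V) * pderiv V" unfolding uv by simp
    also have "\<dots> = V * (u * pderiv U + v * pderiv V)"
      using e by (simp add: algebra_simps)
    finally have dvd: "V dvd pderiv V" by (metis dvd_triv_left)
    have "pderiv V = 0"
    proof (rule ccontr)
      assume "pderiv V \<noteq> 0"
      hence "degree V \<le> degree (pderiv V)" using dvd by (simp add: dvd_imp_degree_le)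
      thus False using degree_pderiv_le_diff[of V] deg_V_eq \<open>j > 0\<close> by simp
    qed
    moreover from this have "pderiv U = 0" using e V_nz by simp
    ultimately show False using pderiv_UV_nz by simp
  qed
  have deg_W: "degree W \<le> n + 2 * j - 1"
    unfolding W_def
  proof (rule degree_diff_le)
    show "degree (pderiv U * V) \<le> n + 2 * j - 1"
      using degree_mult_le[of "pderiv U" V] degree_pderiv_le_diff[of U] deg_U deg_V_eq n by simp
    show "degree (U * pderiv V) \<le> n + 2 * j - 1"
      using degree_mult_le[of U "pderiv V"] degree_pderiv_le_diff[of V] deg_U deg_V_eq \<open>j > 0\<close> by simp
  qed
  have ord_W: "order x W \<ge> order x (U - smult y V) - 1" for x y
  proof -
    let ?k = "order x (U - smult y V)"
    have d: "[:-x, 1:] ^ ?k dvd U - smult y V" by (rule order_1)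
    have "[:-x, 1:] ^ (?k - 1) dvd W" unfolding W_eq[of y]
      by (intro dvd_diff dvd_mult2 linear_power_dvd_pderiv d dvd_trans[OF _ d] le_imp_power_dvd) simp
    thus ?thesis using W_nz by (simp add: order_divides)
  qed
  have ord_W_beta: "order x W \<ge> j - 1" if "x = \<beta> \<or> x = - \<beta>" for x
  proof -
    have "order x V = j" using that j' by (auto simp: j_def)
    hence d: "[:-x, 1:] ^ j dvd V" by (metis order_1)
    have "[:-x, 1:] ^ (j - 1) dvd W" unfolding W_def
      by (intro dvd_diff dvd_mult linear_power_dvd_pderiv d dvd_trans[OF _ d] le_imp_power_dvd) simp
    thus ?thesis using W_nz by (simp add: order_divides)
  qed

  define S where "S = set_mset A"
  define R where "R = (\<lambda>y. {x. poly (U - smult y V) x = 0})"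
  have finR: "finite (R y)" for y unfolding R_def by (rule poly_roots_finite[OF UV_nz])
  have finS: "finite S" by (simp add: S_def)
  have disj: "R y \<inter> R z = {}" if "y \<noteq> z" for y z
    using that UV_root_unique[of y _ z] by (auto simp: R_def)
  have E_nz: "E \<noteq> 0" using deg_E by auto
  have R_union: "(\<Union>y\<in>S. R y) \<subseteq> {x. poly E x = 0}"
  proof safe
    fix y x assume "y \<in> S" "x \<in> R y"
    hence "poly (E ^ (2 * t + 1)) x = 0"
      unfolding num_eq' by (auto simp: S_def R_def poly_prod_mset prod_mset_zero_iff image_iff)
    thus "poly E x = 0" unfolding poly_power power_eq_0_iff by blast
  qed
  have "card (\<Union>y\<in>S. R y) \<le> card {x. poly E x = 0}"
    by (rule card_mono[OF poly_roots_finite[OF E_nz] R_union])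
  hence card_R: "(\<Sum>y\<in>S. card (R y)) \<le> 4 * t + 1"
    using card_poly_roots_bound[OF E_nz] deg_E finR disj finS
    by (subst (asm) card_UN_disjoint) auto
  have "card S * n = (\<Sum>y\<in>S. \<Sum>x\<in>R y. order x (U - smult y V))"
    using sum_order_eq_degree[OF UV_nz finR] deg_UV by (simp add: R_def)
  also have "\<dots> \<le> (\<Sum>y\<in>S. \<Sum>x\<in>R y. order x W + 1)"
    by (intro sum_mono) (use ord_W in \<open>simp add: le_diff_conv\<close>)
  also have "\<dots> = (\<Sum>y\<in>S. \<Sum>x\<in>R y. order x W) + (\<Sum>y\<in>S. card (R y))"
    by (simp only: sum.distrib card_eq_sum)
  also have "(\<Sum>y\<in>S. \<Sum>x\<in>R y. order x W) = (\<Sum>x\<in>(\<Union>y\<in>S. R y). order x W)"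
    using finR finS disj by (subst sum.UNION_disjoint) auto
  finally have 1: "card S * n \<le> (\<Sum>x\<in>(\<Union>y\<in>S. R y). order x W) + (4 * t + 1)"
    using card_R by linarith
  have "(\<Sum>x\<in>(\<Union>y\<in>S. R y). order x W) + (order \<beta> W + order (- \<beta>) W) =
      (\<Sum>x\<in>(\<Union>y\<in>S. R y) \<union> {\<beta>, - \<beta>}. order x W)"
    using R_union E_beta beta finS finR by (subst sum.union_disjoint) auto
  also have "\<dots> \<le> degree W"
  proof -
    have "(\<Sum>x\<in>(\<Union>y\<in>S. R y) \<union> {\<beta>, - \<beta>}. order x W) \<le>
        (\<Sum>x\<in>(\<Union>y\<in>S. R y) \<union> {\<beta>, - \<beta>} \<union> {x. poly W x = 0}. order x W)"
      using finS finR poly_roots_finite[OF W_nz] by (intro sum_mono2) auto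
    also have "\<dots> = degree W"
      using finS finR poly_roots_finite[OF W_nz] by (intro sum_order_eq_degree W_nz) auto
    finally show ?thesis .
  qed
  finally have "(\<Sum>x\<in>(\<Union>y\<in>S. R y). order x W) + (order \<beta> W + order (- \<beta>) W) \<le> n + 2 * j - 1"
    using deg_W by linarith
  hence "card S * n \<le> n + (4 * t + 2)"
    using 1 ord_W_beta[of \<beta>] ord_W_beta[of "- \<beta>"] \<open>j > 0\<close> by simp
  hence "(card S * i) * (2 * t + 1) \<le> (i + 2) * (2 * t + 1)"
    unfolding n_eq by (simp add: algebra_simps)
  hence S_bound: "card S * i \<le> i + 2" by (simp only: mult_le_cancel2)

  have count_dvd: "count A y dvd 2 * t + 1" if "y \<in> S" for y
  proof -
    obtain x where x: "poly (U - smult y V) x = 0"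
      using alg_closed_imp_poly_has_root[of "U - smult y V"] deg_UV[of y] n by auto
    hence "poly E x = 0" using R_union that by (auto simp: R_def)
    hence "order x E = 1" using squarefree E_nz by (simp add: rsquarefree_root_order)
    hence "2 * t + 1 = order x (E ^ (2 * t + 1))"
      by (simp only: order_power[OF E_nz] mult_1_right)
    also have "\<dots> = count A y * order x (U - smult y V)"
      unfolding num_eq' using c order_prod[OF x, of A] by (simp add: order_smult)
    finally show ?thesis by (metis dvd_triv_left)
  qed
  have count_odd: "odd (count A y)" if "y \<in> S" for y
    using count_dvd[OF that] by (meson dvd_trans even_Suc even_mult_iff even_plus_one_iff dvd_triv_left)
  have count_sum: "(\<Sum>y\<in>S. count A y) = m"
    using sizes(1) by (simp add: S_def size_multiset_overloaded_eq)
  have "odd (card S)"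
  proof -
    have "even (\<Sum>y\<in>S. count A y) \<longleftrightarrow> even (card {y \<in> S. odd (count A y)})"
      using finS by (rule even_sum_iff)
    also have "{y \<in> S. odd (count A y)} = S" using count_odd by auto
    finally show ?thesis using count_sum odd_mi by simp
  qed
  have "card S \<noteq> 1"
  proof
    assume "card S = 1"
    then obtain y where y: "S = {y}" by (auto simp: card_1_singleton_iff)
    hence "m dvd 2 * t + 1" using count_dvd[of y] count_sum by simp
    hence "m dvd 2 * (2 * t + 1) - (4 * t + 1)" using m_dvd by (intro dvd_diff_nat dvd_mult)
    thus False using m by simp
  qed
  hence S3: "card S \<ge> 3" using \<open>odd (card S)\<close> by (metis One_nat_def Suc_1 even_Suc le_antisym not_less_eq_eq numeral_3_eq_3 odd_pos Suc_leI)
  hence "3 * i \<le> i + 2" using S_bound by (metis le_trans mult_le_mono1)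
  hence i1: "i = 1" using odd_mi by (cases i) auto
  hence "card S = 3" using S_bound S3 by simp
  then obtain x y z where xyz: "S = {x, y, z}" "x \<noteq> y" "y \<noteq> z" "x \<noteq> z"
    by (auto simp: card_3_iff)
  have sum3: "count A x + count A y + count A z = 4 * t + 1"
    using count_sum i i1 xyz by simp
  have small: "count A y = 2 * t + 1 \<or> 3 * count A y \<le> 2 * t + 1" if "y \<in> S" for y
  proof -
    obtain k where k: "2 * t + 1 = count A y * k" using count_dvd[OF \<open>y \<in> S\<close>] by (elim dvdE)
    have "odd k" by (metis k even_add even_mult_iff even_numeral odd_one)
    hence "k = 1 \<or> 3 \<le> k" by (metis One_nat_def Suc_1 even_Suc le_antisym not_less_eq_eq numeral_3_eq_3 odd_pos Suc_leI)
    thus ?thesis using k by (auto simp: mult.commute)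
  qed
  show False using small[of x] small[of y] small[of z] sum3 t xyz(1)
    by auto
qed

lemma decomposition: "t = 2 \<and> (poly V \<beta> = 0 \<longleftrightarrow> poly V (- \<beta>) \<noteq> 0)"
proof (cases "poly V \<beta> = 0")
  case True
  thus ?thesis using inner_poles_at_both inner_pole_at_one by blast
next
  case False
  hence V: "poly V (- \<beta>) = 0" using inner_pole_at_none by blast
  have neg: "dickson_quotient_decomposition E t (- \<beta>) U V A B c c' m n"
    using t beta squarefree deg_E separable E_beta no_common_root deg_U deg_V n m
      size_le size_eq c num_eq den_eq
    by unfold_locales (simp_all only: minus_minus mult.commute, auto)
  show ?thesis using dickson_quotient_decomposition.inner_pole_at_one[OF neg] V False by simp
qed

end

section \<open>Compositions in terms of binary forms\<close>

lemma to_fract_power: "to_fract (x ^ n) = to_fract x ^ n"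
  by (induction n) simp_all

lemma to_fract_sum: "to_fract (sum F I) = (\<Sum>i\<in>I. to_fract (F i))"
  by (induction I rule: infinite_finite_induct) simp_all

lemma homog_to_fract:
  fixes G H1 H2 :: "'a :: field poly"
  assumes "degree G \<le> m" "H2 \<noteq> 0"
  shows "poly (map_poly (\<lambda>c. Fract [:c:] 1) G) (Fract H1 H2) * to_fract (H2 ^ m) =
         to_fract (homog m G H1 H2)"
proof -
  have z: "Fract 0 1 = (0 :: 'a poly fract)" by (simp add: fract_collapse)
  have deg: "degree (map_poly (\<lambda>c. Fract [:c:] 1) G) = degree G"
    by (rule degree_map_poly) (simp add: Zero_fract_def eq_fract)
  have q: "Fract H1 H2 = to_fract H1 / to_fract H2"
    using assms(2) by (simp add: to_fract_def)
  have nz: "to_fract H2 \<noteq> 0" using assms(2) by simp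
  have "poly (map_poly (\<lambda>c. Fract [:c:] 1) G) (Fract H1 H2) =
      (\<Sum>i\<le>m. Fract [:coeff G i:] 1 * (to_fract H1 / to_fract H2) ^ i)"
    unfolding q poly_altdef
    by (rule sum.mono_neutral_cong_left)
       (use assms in \<open>auto simp: z coeff_map_poly coeff_eq_0 deg\<close>)
  hence "poly (map_poly (\<lambda>c. Fract [:c:] 1) G) (Fract H1 H2) * to_fract (H2 ^ m) =
      (\<Sum>i\<le>m. Fract [:coeff G i:] 1 * (to_fract H1 / to_fract H2) ^ i * to_fract H2 ^ m)"
    by (simp add: sum_distrib_right to_fract_power)
  also have "\<dots> = (\<Sum>i\<le>m. to_fract (smult (coeff G i) (H1 ^ i * H2 ^ (m - i))))"
  proof (rule sum.cong)
    fix i assume "i \<in> {..m}"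
    hence 1: "to_fract H2 ^ m = to_fract H2 ^ i * to_fract H2 ^ (m - i)"
      by (simp flip: power_add)
    have 2: "(to_fract H1 / to_fract H2) ^ i * to_fract H2 ^ i = to_fract H1 ^ i"
      using nz by (simp flip: power_mult_distrib)
    have "smult (coeff G i) (H1 ^ i * H2 ^ (m - i)) = [:coeff G i:] * (H1 ^ i * H2 ^ (m - i))"
      by simp
    hence "to_fract (smult (coeff G i) (H1 ^ i * H2 ^ (m - i))) =
        Fract [:coeff G i:] 1 * (to_fract H1 ^ i * to_fract H2 ^ (m - i))"
      by (simp only: to_fract_mult to_fract_power to_fract_def[symmetric])
    also have "\<dots> = Fract [:coeff G i:] 1 * (to_fract H1 / to_fract H2) ^ i * to_fract H2 ^ m"
      unfolding 1 by (subst 2[symmetric]) (simp only: mult_ac)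
    finally show "Fract [:coeff G i:] 1 * (to_fract H1 / to_fract H2) ^ i * to_fract H2 ^ m =
        to_fract (smult (coeff G i) (H1 ^ i * H2 ^ (m - i)))" by simp
  qed simp
  also have "\<dots> = to_fract (homog m G H1 H2)" by (simp add: homog_def to_fract_sum)
  finally show ?thesis .
qed

lemma rf_compose_homog:
  fixes g h :: "'a :: field poly fract"
  assumes f: "Fract P Q = rf_compose g h" and PQ: "P \<noteq> 0" "Q \<noteq> 0"
  defines "m \<equiv> rf_degree g"
  shows "P * homog m (rf_den g) (rf_num h) (rf_den h) =
           homog m (rf_num g) (rf_num h) (rf_den h) * Q"
    and "homog m (rf_den g) (rf_num h) (rf_den h) \<noteq> 0"
proof -
  define N where "N = (\<lambda>G. poly (map_poly (\<lambda>c. Fract [:c:] 1) G) h)"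
  have e: "N G * to_fract (rf_den h ^ m) = to_fract (homog m G (rf_num h) (rf_den h))"
    if "degree G \<le> m" for G
    using homog_to_fract[OF that rf_den_nonzero[of h], of "rf_num h"]
    by (simp only: Fract_rf_num_den N_def)
  have d: "to_fract (rf_den h ^ m) \<noteq> 0" by (simp add: rf_den_nonzero)
  have f': "to_fract P / to_fract Q = N (rf_num g) / N (rf_den g)"
    using f PQ by (simp add: rf_compose_def N_def to_fract_def)
  moreover have "to_fract P / to_fract Q \<noteq> 0" using PQ by simp
  ultimately have nz: "N (rf_den g) \<noteq> 0" by auto
  have e1: "N (rf_num g) * to_fract (rf_den h ^ m) = to_fract (homog m (rf_num g) (rf_num h) (rf_den h))"
    and e2: "N (rf_den g) * to_fract (rf_den h ^ m) = to_fract (homog m (rf_den g) (rf_num h) (rf_den h))"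
    by (rule e, simp add: m_def rf_degree_def)+
  have "to_fract (homog m (rf_den g) (rf_num h) (rf_den h)) \<noteq> 0"
    using nz d unfolding e2[symmetric] by simp
  thus "homog m (rf_den g) (rf_num h) (rf_den h) \<noteq> 0" by auto
  have "to_fract P * N (rf_den g) = N (rf_num g) * to_fract Q"
    using f' nz PQ by (simp add: field_simps)
  hence "to_fract P * (N (rf_den g) * to_fract (rf_den h ^ m)) =
      (N (rf_num g) * to_fract (rf_den h ^ m)) * to_fract Q"
    by (simp only: mult.assoc[symmetric]) (simp only: mult_ac)
  hence "to_fract (P * homog m (rf_den g) (rf_num h) (rf_den h)) =
      to_fract (homog m (rf_num g) (rf_num h) (rf_den h) * Q)"
    unfolding e1 e2 by simp
  thus "P * homog m (rf_den g) (rf_num h) (rf_den h) =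
      homog m (rf_num g) (rf_num h) (rf_den h) * Q" by (simp only: to_fract_eq_iff)
qed

lemma map_poly_to_ac_homog:
  "map_poly to_ac (homog m G U V) =
     homog m (map_poly to_ac G) (map_poly to_ac U) (map_poly to_ac V)"
  by (simp add: homog_def map_poly_to_ac_sum map_poly_to_ac_smult map_poly_to_ac_mult
      map_poly_to_ac_power coeff_map_poly)

text \<open>
  The combination \<open>V\<close> of \<open>H1\<close>, \<open>H2\<close> below is the member of the pencil spanned by \<open>H1\<close> and \<open>H2\<close> of degree
  less than \<open>n\<close>; replacing \<open>H1/H2\<close> by \<open>U/V\<close> moves the image of infinity to infinity.
\<close>

lemma pencil_basis:
  fixes H1 H2 :: "'a :: field poly"
  assumes cop: "coprime H1 H2" and n: "n = max (degree H1) (degree H2)" "n \<ge> 1"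
  defines "V \<equiv> smult (coeff H2 n) H1 - smult (coeff H1 n) H2"
  obtains U a b c d where "H1 = smult a U + smult b V" "H2 = smult c U + smult d V"
    "a * d - b * c \<noteq> 0" "degree U = n" "degree V < n" "coprime U V"
proof -
  have "degree V \<le> n" unfolding V_def
    by (intro degree_diff_le order.trans[OF degree_smult_le]) (auto simp: n)
  moreover have "coeff V n = 0" by (simp add: V_def)
  ultimately have dV: "degree V < n"
    using n(2) by (metis degree_0 le_neq_implies_less leading_coeff_0_iff less_le_trans zero_less_one)
  have c: "coprime U V" if "H1 = smult a U + smult b V" "H2 = smult c U + smult d V" for U a b c d
  proof (rule coprimeI)
    fix w assume "w dvd U" "w dvd V"
    hence "w dvd H1" "w dvd H2" unfolding that by (auto intro: dvd_add dvd_smult)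
    thus "is_unit w" using cop by (rule coprime_common_divisor[rotated])
  qed
  show ?thesis
  proof (cases "coeff H1 n = 0")
    case False
    have 1: "H1 = smult 1 H1 + smult 0 V"
      "H2 = smult (coeff H2 n / coeff H1 n) H1 + smult (- 1 / coeff H1 n) V"
      using False by (simp_all add: V_def smult_diff_right)
    have "degree H1 = n" using False n by (metis le_antisym le_degree max.cobounded1)
    thus ?thesis using that[OF 1] c[OF 1] dV False by simp
  next
    case True
    have H2: "coeff H2 n \<noteq> 0"
    proof
      assume 0: "coeff H2 n = 0"
      have "degree H1 = n \<or> degree H2 = n" using n by (auto simp: max_def)
      thus False using 0 True n(2) by (metis degree_0 leading_coeff_0_iff not_one_le_zero)
    qed
    have 1: "H1 = smult 0 H2 + smult (1 / coeff H2 n) V" "H2 = smult 1 H2 + smult 0 V"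
      using H2 True by (simp_all add: V_def)
    have "degree H2 = n" using H2 n by (metis le_antisym le_degree max.cobounded2)
    thus ?thesis using that[OF 1] c[OF 1] dV H2 by simp
  qed
qed

lemma homog_normal_form:
  fixes G1 G2 H1 H2 P Q :: "'a :: alg_closed_field poly"
  assumes G: "coprime G1 G2" "m = max (degree G1) (degree G2)"
    and H: "coprime H1 H2" "n = max (degree H1) (degree H2)" "n \<ge> 1"
    and PQ: "coprime P Q" "P \<noteq> 0" "Q \<noteq> 0"
    and eq: "P * homog m G2 H1 H2 = homog m G1 H1 H2 * Q"
    and nz: "homog m G2 H1 H2 \<noteq> 0"
  defines "V \<equiv> smult (coeff H2 n) H1 - smult (coeff H1 n) H2"
  obtains U A B c c' where "coprime U V" "degree U = n" "degree V < n"
    "size A \<le> m" "size B \<le> m" "size A = m \<or> size B = m" "c \<noteq> 0" "c' \<noteq> 0"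
    "P = smult c ((\<Prod>y\<in>#A. U - smult y V) * V ^ (m - size A))"
    "Q = smult c' ((\<Prod>y\<in>#B. U - smult y V) * V ^ (m - size B))"
proof -
  have nz1: "homog m G1 H1 H2 \<noteq> 0" using eq nz PQ by auto
  hence G_nz: "G1 \<noteq> 0" "G2 \<noteq> 0" using nz by (auto simp: homog_def)
  have "coprime (homog m G1 H1 H2) (homog m G2 H1 H2)"
    using homog_common_root[OF G] coprime_no_common_root[OF H(1)]
    by (intro coprimeI_no_common_root) blast
  from coprime_Fract_eqE[OF PQ(1,3) this nz eq]
  obtain k where k: "k \<noteq> 0" "P = smult k (homog m G1 H1 H2)" "Q = smult k (homog m G2 H1 H2)"
    by metis
  obtain c1 L1 where L1: "c1 \<noteq> 0" "size L1 = m" "(0, 0) \<notin># L1"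
    "\<And>U V. homog m G1 U V = smult c1 (linear_forms_prod U V L1)"
    using homog_split[OF G_nz(1), of m] G(2) by auto
  obtain c2 L2 where L2: "c2 \<noteq> 0" "size L2 = m" "(0, 0) \<notin># L2"
    "\<And>U V. homog m G2 U V = smult c2 (linear_forms_prod U V L2)"
    using homog_split[OF G_nz(2), of m] G(2) by auto
  obtain U a b c d where UV: "H1 = smult a U + smult b V" "H2 = smult c U + smult d V"
    "a * d - b * c \<noteq> 0" "degree U = n" "degree V < n" "coprime U V"
    unfolding V_def by (rule pencil_basis[OF H])
  define T where "T = (\<lambda>(s, t). (s * a + t * c, s * b + t * d))"
  note ch1 = linear_forms_prod_change[OF UV(1-3) L1(3), folded T_def]
  note ch2 = linear_forms_prod_change[OF UV(1-3) L2(3), folded T_def]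
  have not_both: "\<not> ((0, s) \<in># image_mset T L1 \<and> (0, s') \<in># image_mset T L2)" for s s'
  proof
    assume *: "(0, s) \<in># image_mset T L1 \<and> (0, s') \<in># image_mset T L2"
    have "linear_forms_prod [:a:] [:c:] L = 0" if "(0, s) \<in># image_mset T L" "(0, 0) \<notin># L" for L s
    proof -
      have "linear_forms_prod [:a:] [:c:] L = linear_forms_prod 1 0 (image_mset T L)"
        unfolding T_def by (rule linear_forms_prod_change(1)[OF _ _ UV(3) that(2)]) simp_all
      moreover have "0 \<in># image_mset (\<lambda>(s, t). smult s 1 + smult t 0) (image_mset T L)"
        using that(1) by (force simp del: image_mset.compositionality)
      ultimately show ?thesis by (simp only: linear_forms_prod_def prod_mset_zero_iff)
    qed
    hence "poly (homog m G1 [:a:] [:c:]) 0 = 0" "poly (homog m G2 [:a:] [:c:]) 0 = 0"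
      using * L1(3) L2(3) unfolding L1(4) L2(4) by (metis poly_0 smult_0_right)+
    from homog_common_root[OF G this] show False using UV(3) by simp
  qed
  obtain e1 A where A: "e1 \<noteq> 0" "size A \<le> m" "size A < m \<Longrightarrow> \<exists>t. (0, t) \<in># image_mset T L1"
    "linear_forms_prod U V (image_mset T L1) = smult e1 ((\<Prod>y\<in>#A. U - smult y V) * V ^ (m - size A))"
    using linear_forms_prod_normal[OF ch1(2), of U V] L1(2) unfolding size_image_mset by auto
  obtain e2 B where B: "e2 \<noteq> 0" "size B \<le> m" "size B < m \<Longrightarrow> \<exists>t. (0, t) \<in># image_mset T L2"
    "linear_forms_prod U V (image_mset T L2) = smult e2 ((\<Prod>y\<in>#B. U - smult y V) * V ^ (m - size B))"
    using linear_forms_prod_normal[OF ch2(2), of U V] L2(2) unfolding size_image_mset by auto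
  have "size A = m \<or> size B = m" using A(2,3) B(2,3) not_both by (meson le_neq_implies_less)
  moreover have "P = smult (k * (c1 * e1)) ((\<Prod>y\<in>#A. U - smult y V) * V ^ (m - size A))"
    unfolding k(2) L1(4) ch1(1) A(4) by simp
  moreover have "Q = smult (k * (c2 * e2)) ((\<Prod>y\<in>#B. U - smult y V) * V ^ (m - size B))"
    unfolding k(3) L2(4) ch2(1) B(4) by simp
  ultimately show ?thesis using UV(4-6) A(1,2) B(1,2) k(1) L1(1) L2(1)
    by (intro that[of U A B "k * (c1 * e1)" "k * (c2 * e2)"]) auto
qed

context dickson_quotient
begin

lemma coprime_num_den:
  "coprime (E ^ (2 * t + 1)) (([:-\<beta>, 1:] * [:\<beta>, 1:]) ^ (t * (4 * t + 1)))"
proof (rule coprimeI_no_common_root)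
  fix x assume 1: "poly (E ^ (2 * t + 1)) x = 0"
    and "poly (([:-\<beta>, 1:] * [:\<beta>, 1:]) ^ (t * (4 * t + 1))) x = 0"
  hence "x = \<beta> \<or> x = - \<beta>"
    unfolding poly_power poly_mult power_eq_0_iff mult_eq_0_iff
    by (auto simp: eq_neg_iff_add_eq_0 add.commute)
  with 1 E_beta show False unfolding poly_power power_eq_0_iff by blast
qed

theorem homog_decomposition:
  assumes G: "coprime G1 G2" "m = max (degree G1) (degree G2)" "m \<ge> 2"
    and H: "coprime H1 H2" "n = max (degree H1) (degree H2)" "n \<ge> 2"
    and eq: "E ^ (2 * t + 1) * homog m G2 H1 H2 =
      homog m G1 H1 H2 * ([:-\<beta>, 1:] * [:\<beta>, 1:]) ^ (t * (4 * t + 1))"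
    and nz: "homog m G2 H1 H2 \<noteq> 0"
  defines "V \<equiv> smult (coeff H2 n) H1 - smult (coeff H1 n) H2"
  shows "t = 2 \<and> (poly V \<beta> = 0 \<longleftrightarrow> poly V (- \<beta>) \<noteq> 0)"
proof -
  have E: "E \<noteq> 0" using deg_E by auto
  have n1: "n \<ge> 1" using H(3) by simp
  have nzs: "E ^ (2 * t + 1) \<noteq> 0" "([:-\<beta>, 1:] * [:\<beta>, 1:]) ^ (t * (4 * t + 1)) \<noteq> 0"
    using E unfolding power_eq_0_iff by auto
  obtain U A B c c' where "coprime U V" "degree U = n" "degree V < n"
    "size A \<le> m" "size B \<le> m" "size A = m \<or> size B = m" "c \<noteq> 0" "c' \<noteq> 0"
    "E ^ (2 * t + 1) = smult c ((\<Prod>y\<in>#A. U - smult y V) * V ^ (m - size A))"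
    "([:-\<beta>, 1:] * [:\<beta>, 1:]) ^ (t * (4 * t + 1)) =
       smult c' ((\<Prod>y\<in>#B. U - smult y V) * V ^ (m - size B))"
    unfolding V_def by (rule homog_normal_form[OF G(1,2) H(1,2) n1 coprime_num_den nzs eq nz])
  hence "dickson_quotient_decomposition E t \<beta> U V A B c c' m n"
    using G(3) H(3) coprime_no_common_root by unfold_locales blast+
  thus ?thesis by (rule dickson_quotient_decomposition.decomposition)
qed

end

section \<open>Dickson polynomials in odd characteristic\<close>

lemma dickson2_eq_sum:
  assumes "r div 2 \<le> N"
  shows "dickson2 r a = (\<Sum>i\<le>N. monom (of_nat ((r - i) choose i) * (- a) ^ i) (r - 2 * i))"
  unfolding dickson2_def
proof (rule sum.mono_neutral_left)
  show "\<forall>i\<in>{..N} - {..r div 2}. monom (of_nat ((r - i) choose i) * (- a) ^ i) (r - 2 * i) = 0"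
  proof
    fix i assume "i \<in> {..N} - {..r div 2}"
    hence "r - i < i" by auto
    thus "monom (of_nat ((r - i) choose i) * (- a) ^ i) (r - 2 * i) = 0"
      by (simp add: binomial_eq_0)
  qed
qed (use assms in auto)

lemma dickson2_rec:
  "dickson2 (Suc (Suc n)) a = [:0, 1:] * dickson2 (Suc n) a - smult a (dickson2 n a)"
proof -
  define T where "T = (\<lambda>r i. monom (of_nat ((r - i) choose i) * (- a) ^ i) (r - 2 * i))"
  have d: "dickson2 r a = (\<Sum>i\<le>N. T r i)" if "r div 2 \<le> N" for r N
    unfolding T_def by (rule dickson2_eq_sum[OF that])
  have X: "[:0, 1:] * monom c k = monom c (Suc k)" for c :: 'a and k
    by (simp add: monom_Suc)
  have step: "T (Suc (Suc n)) (Suc j) = [:0, 1:] * T (Suc n) (Suc j) - smult a (T n j)" for j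
  proof (cases "j \<le> n")
    case False
    thus ?thesis by (cases j) (simp_all add: T_def)
  next
    case True
    hence "Suc n - j = Suc (n - j)" by simp
    hence "T (Suc (Suc n)) (Suc j) =
        monom (of_nat ((n - j) choose Suc j) * (- a) ^ Suc j) (n - 2 * j) - smult a (T n j)"
      by (intro poly_eqI) (simp add: T_def algebra_simps)
    moreover have "monom (of_nat ((n - j) choose Suc j) * (- a) ^ Suc j) (n - 2 * j) =
        [:0, 1:] * T (Suc n) (Suc j)"
    proof (cases "Suc j \<le> n - j")
      case True
      hence "Suc (Suc n - 2 * Suc j) = n - 2 * j" by simp
      thus ?thesis unfolding T_def X by simp
    next
      case False
      hence "(n - j) choose Suc j = 0" by (simp add: binomial_eq_0)
      thus ?thesis by (simp only: T_def diff_Suc_Suc) simp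
    qed
    ultimately show ?thesis by simp
  qed
  have "dickson2 (Suc (Suc n)) a = (\<Sum>i\<le>Suc n. T (Suc (Suc n)) i)" by (rule d) simp
  also have "\<dots> = T (Suc (Suc n)) 0 + (\<Sum>j\<le>n. T (Suc (Suc n)) (Suc j))"
    by (rule sum.atMost_Suc_shift)
  also have "\<dots> = [:0, 1:] * (T (Suc n) 0 + (\<Sum>j\<le>n. T (Suc n) (Suc j))) - smult a (\<Sum>j\<le>n. T n j)"
  proof -
    have "T (Suc (Suc n)) 0 = [:0, 1:] * T (Suc n) 0" by (simp add: T_def monom_Suc)
    moreover have "smult a p = [:a:] * p" for p by simp
    ultimately show ?thesis unfolding step
      by (simp only: sum_subtractf sum_distrib_left distrib_left add_diff_eq)
  qed
  also have "T (Suc n) 0 + (\<Sum>j\<le>n. T (Suc n) (Suc j)) = dickson2 (Suc n) a"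
    by (subst d[of _ "Suc n"]) (simp, rule sum.atMost_Suc_shift[symmetric])
  also have "(\<Sum>j\<le>n. T n j) = dickson2 n a" by (rule d[symmetric]) simp
  finally show ?thesis .
qed

lemma poly_dickson2_functional:
  fixes x y :: "'a :: comm_ring_1"
  shows "poly (dickson2 n (x * y)) (x + y) * (x - y) = x ^ Suc n - y ^ Suc n"
proof (induction n rule: induct_nat_012)
  case 0
  show ?case by (simp add: dickson2_def monom_0)
next
  case 1
  show ?case by (simp add: dickson2_def monom_Suc algebra_simps power2_eq_square)
next
  case (ge2 n)
  have "poly (dickson2 (Suc (Suc n)) (x * y)) (x + y) * (x - y) =
      (x + y) * (poly (dickson2 (Suc n) (x * y)) (x + y) * (x - y))
      - x * y * (poly (dickson2 n (x * y)) (x + y) * (x - y))"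
    by (simp add: dickson2_rec algebra_simps)
  also have "\<dots> = x ^ Suc (Suc (Suc n)) - y ^ Suc (Suc (Suc n))"
    unfolding ge2 by (simp add: algebra_simps)
  finally show ?case .
qed

lemma degree_dickson2_le: "degree (dickson2 r a) \<le> r"
  unfolding dickson2_def
  by (rule degree_sum_le) (auto intro: order.trans[OF degree_monom_le])

lemma coeff_dickson2: "coeff (dickson2 r a) r = 1"
proof -
  have "coeff (dickson2 r a) r =
      (\<Sum>i\<in>{0}. coeff (monom (of_nat ((r - i) choose i) * (- a) ^ i) (r - 2 * i)) r)"
    unfolding dickson2_def coeff_sum by (rule sum.mono_neutral_right) auto
  thus ?thesis by simp
qed

lemma degree_dickson2: "degree (dickson2 r (a :: 'a :: comm_ring_1)) = r"
  using degree_dickson2_le[of r a] le_degree[of "dickson2 r a" r] coeff_dickson2[of r a] by simp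

lemma map_poly_to_ac_dickson2: "map_poly to_ac (dickson2 r a) = dickson2 r (to_ac a)"
  unfolding dickson2_def map_poly_to_ac_sum
  by (intro sum.cong refl) (simp add: map_poly_monom)

lemma infinite_UNIV_alg_closed: "infinite (UNIV :: 'a :: alg_closed_field set)"
proof
  assume fin: "finite (UNIV :: 'a set)"
  define p where "p = (\<Prod>x\<in>UNIV. [:-x, 1 :: 'a:]) + 1"
  have "degree (\<Prod>x\<in>UNIV. [:-x, 1 :: 'a:]) = card (UNIV :: 'a set)"
    by (subst degree_prod_eq_sum_degree) auto
  moreover have "card (UNIV :: 'a set) > 0" using fin by (simp add: card_gt_0_iff)
  ultimately have "degree p > 0" unfolding p_def by (subst degree_add_eq_left) auto
  then obtain x where "poly p x = 0" using alg_closed_imp_poly_has_root by blast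
  moreover have "(\<Prod>y\<in>UNIV. x - y) = 0" using fin by (simp add: prod_zero_iff)
  ultimately show False by (simp add: p_def poly_prod)
qed

locale dickson_alg_closed =
  fixes A :: "'a :: alg_closed_field" and t :: nat
  assumes t: "t \<ge> 2" and A: "A \<noteq> 0" and two: "(2 :: 'a) \<noteq> 0"
    and frob: "\<And>x y :: 'a. (x + y) ^ (4 * t + 1) = x ^ (4 * t + 1) + y ^ (4 * t + 1)"
    and of_nat_r: "of_nat (4 * t + 1) = (0 :: 'a)"
begin

abbreviation r :: nat where "r \<equiv> 4 * t + 1"
abbreviation D :: "'a poly" where "D \<equiv> [:- 4 * A, 0, 1:]"
abbreviation E :: "'a poly" where "E \<equiv> dickson2 r A"

lemma frob_diff: "(x - y) ^ r = x ^ r - y ^ r" for x y :: 'a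
  using frob[of x "- y"] power_minus_odd[of r y] by simp

lemma two_power_r: "(2 :: 'a) ^ r = 2"
  using frob[of 1 1] by simp

lemma dickson2_closed_form: "smult 2 E = [:0, 1:] * D ^ (2 * t) + monom 1 r"
proof -
  define p where "p = smult 2 E - ([:0, 1:] * D ^ (2 * t) + monom 1 r)"
  have "poly (D * p) c = 0" for c
  proof -
    obtain \<delta> where \<delta>: "\<delta> ^ 2 = c ^ 2 - 4 * A"
      using nth_root_exists[of 2 "c ^ 2 - 4 * A"] by auto
    define x y where "x = (c + \<delta>) / 2" and "y = (c - \<delta>) / 2"
    have xy: "2 * x = c + \<delta>" "2 * y = c - \<delta>" using two by (simp_all add: x_def y_def)
    have four: "(4 :: 'a) \<noteq> 0" using two by (metis mult_2 mult_eq_0_iff numeral_Bit0)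
    have s: "x + y = c" "x - y = \<delta>"
      using two four by (simp_all add: x_def y_def field_simps)
    have "4 * (x * y) = (2 * x) * (2 * y)" by simp
    also have "\<dots> = 4 * A" unfolding xy using \<delta> by (simp add: algebra_simps power2_eq_square)
    finally have xyA: "x * y = A" using four by simp
    have "2 * x ^ r = (2 * x) ^ r" "2 * y ^ r = (2 * y) ^ r"
      unfolding power_mult_distrib two_power_r by simp_all
    hence pr: "2 * x ^ r = c ^ r + \<delta> ^ r" "2 * y ^ r = c ^ r - \<delta> ^ r"
      unfolding xy frob frob_diff by simp_all
    have "2 * (2 * (poly E c * \<delta>)) = (2 * x) * (2 * x ^ r) - (2 * y) * (2 * y ^ r)"
      using poly_dickson2_functional[of r x y, unfolded xyA s power_Suc]
      by (simp only:) (simp add: algebra_simps)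
    also have "\<dots> = 2 * (c ^ r * \<delta> + c * \<delta> ^ r)"
      unfolding pr unfolding xy by (simp add: algebra_simps)
    finally have "2 * (poly E c * \<delta>) = c ^ r * \<delta> + c * \<delta> ^ r"
      using two by (simp only: mult_left_cancel not_False_eq_True)
    hence "2 * poly E c * \<delta> ^ 2 = c ^ r * \<delta> ^ 2 + c * (\<delta> * \<delta> ^ r)"
      by (simp add: algebra_simps power2_eq_square)
    also have "\<delta> * \<delta> ^ r = \<delta> ^ 2 * (\<delta> ^ 2) ^ (2 * t)"
    proof -
      have "\<delta> * \<delta> ^ r = \<delta> ^ (2 + 2 * (2 * t))" by simp
      thus ?thesis unfolding power_add power_mult[of \<delta> 2 "2 * t"] .
    qed
    finally have "\<delta> ^ 2 * (2 * poly E c - (c * (\<delta> ^ 2) ^ (2 * t) + c ^ r)) = 0"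
      by (simp add: algebra_simps)
    thus ?thesis unfolding \<delta> p_def
      by (simp add: poly_monom power2_eq_square algebra_simps)
  qed
  hence "D * p = 0" using poly_roots_finite[of "D * p"] infinite_UNIV_alg_closed[where ?'a = 'a]
    by (metis (mono_tags, lifting) Collect_cong UNIV_def)
  moreover have "D \<noteq> 0" by simp
  ultimately have "p = 0" by (simp only: mult_eq_0_iff simp_thms)
  thus ?thesis by (simp add: p_def)
qed

lemma poly_dickson2_closed_form: "2 * poly E x = x * (x ^ 2 - 4 * A) ^ (2 * t) + x ^ r"
  using arg_cong[OF dickson2_closed_form, of "\<lambda>p. poly p x"]
  by (simp add: poly_monom power2_eq_square algebra_simps)

lemma pderiv_dickson2: "smult 2 (pderiv E) = smult (- 4 * A) (D ^ (2 * t - 1))"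
proof -
  have dD: "pderiv D = [:0, 2:]" by (simp add: pderiv_pCons)
  obtain j where j: "2 * t = Suc j" using t by (cases "2 * t") auto
  have "smult 2 (pderiv E) = pderiv ([:0, 1:] * D ^ (2 * t)) + pderiv (monom 1 r)"
    unfolding pderiv_smult[symmetric] dickson2_closed_form pderiv_add ..
  also have "pderiv (monom 1 r) = (0 :: 'a poly)"
    by (simp only: pderiv_monom of_nat_r) simp
  also have "pderiv ([:0, 1:] * D ^ (2 * t)) =
      D ^ (2 * t) + [:0, 1:] * (smult (of_nat (2 * t)) (D ^ j) * [:0, 2:])"
    unfolding j pderiv_mult pderiv_power_Suc dD by (simp add: pderiv_pCons)
  also have "\<dots> = D ^ j * (D + smult (of_nat (2 * t)) ([:0, 1:] * [:0, 2:]))"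
  proof -
    have "P * G + F * (smult k G * H) = G * (P + smult k (F * H))" for P F G H :: "'a poly" and k
      by (simp add: algebra_simps)
    thus ?thesis unfolding j power_Suc .
  qed
  also have "smult (of_nat (2 * t)) ([:0, 1:] * [:0, 2:]) = [:0, 0, - 1 :: 'a:]"
  proof -
    have "of_nat (2 * t) * 2 + (1 :: 'a) = 0" using of_nat_r by (simp add: algebra_simps)
    thus ?thesis by (simp add: eq_neg_iff_add_eq_0)
  qed
  also have "D + [:0, 0, - 1:] = [:- 4 * A:]" by simp
  finally show ?thesis unfolding j by simp
qed

lemma dickson2_nonzero_at: "poly E x \<noteq> 0" if "x ^ 2 = 4 * A" for x
proof -
  have "(4 :: 'a) \<noteq> 0" using two by (metis mult_2 mult_eq_0_iff numeral_Bit0)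
  hence "x \<noteq> 0" using that A by auto
  moreover have "2 * poly E x = x ^ r" using poly_dickson2_closed_form[of x] that t by simp
  ultimately show ?thesis by (metis mult_zero_right power_eq_0_iff)
qed

lemma dickson_quotient_E:
  assumes "\<beta> ^ 2 = 4 * A"
  shows "dickson_quotient E t \<beta>"
proof
  have four: "(4 :: 'a) \<noteq> 0" using two by (metis mult_2 mult_eq_0_iff numeral_Bit0)
  hence "\<beta> \<noteq> 0" using assms A by auto
  thus "\<beta> \<noteq> - \<beta>" using two by (simp add: eq_neg_iff_add_eq_0 mult_2[symmetric])
  show "poly E \<beta> \<noteq> 0" "poly E (- \<beta>) \<noteq> 0" using dickson2_nonzero_at assms by simp_all
  show "degree E = 4 * t + 1" by (rule degree_dickson2)
  hence E_nz: "E \<noteq> 0" by auto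
  have D_nz: "smult (- 4 * A) (D ^ (2 * t - 1)) \<noteq> 0" using four A by simp
  show "rsquarefree E"
    unfolding rsquarefree_def
  proof (intro conjI allI E_nz, rule ccontr)
    fix x assume "\<not> (order x E = 0 \<or> order x E = 1)"
    hence "[:-x, 1:] ^ 2 dvd E" by (intro dvd_trans[OF le_imp_power_dvd order_1]) simp
    from linear_power_dvd_pderiv[OF this] have "poly (pderiv E) x = 0"
      by (simp add: poly_eq_0_iff_dvd)
    hence "poly (smult 2 (pderiv E)) x = 0" by simp
    hence "x ^ 2 = 4 * A" unfolding pderiv_dickson2 using four A
      by (simp add: power2_eq_square)
    hence "poly E x \<noteq> 0" by (rule dickson2_nonzero_at)
    moreover have "poly E x = 0"
      using \<open>\<not> (order x E = 0 \<or> order x E = 1)\<close> E_nz by (simp add: order_root)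
    ultimately show False by simp
  qed
  have "2 * of_nat (2 * t + 1) = (1 :: 'a)" using of_nat_r by (simp add: algebra_simps)
  hence "of_nat (2 * t + 1) \<noteq> (0 :: 'a)" by (metis mult_zero_right zero_neq_one)
  moreover have "pderiv E \<noteq> 0" using pderiv_dickson2 D_nz by auto
  moreover have "pderiv (E ^ (2 * t + 1)) = smult (of_nat (2 * t + 1)) (E ^ (2 * t)) * pderiv E"
    using pderiv_power_Suc[of E "2 * t"] by (simp only: Suc_eq_plus1)
  ultimately show "pderiv (E ^ (2 * t + 1)) \<noteq> 0" using E_nz
    by (simp only: mult_eq_0_iff smult_eq_0_iff power_eq_0_iff) blast
  show "2 \<le> t" by (rule t)
qed

end

section \<open>Injectivity on Frobenius-fixed points\<close>

text \<open>
  Writing \<open>c = b (y + 1/y)\<close> with \<open>y = v\<^bsup>(r-1)/2\<^esup>\<close> turns \<open>f\<^sup>2\<close> into the quotient map of the projective line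
  by \<open>PGL\<^sub>2(F\<^sub>r)\<close>. A point \<open>c\<close> is fixed by the \<open>Q\<close>-Frobenius iff Frobenius maps \<open>v\<close> to \<open>\<lambda>v\<close> or \<open>\<lambda>/v\<close> for a
  nonsquare \<open>\<lambda>\<close> of \<open>F\<^sub>r\<close>, that is, \<open>\<lambda>\<^bsup>2t\<^esup> = -1\<close>. The assumptions \<open>M1\<close> and \<open>M2\<close> say that \<open>Q + 1\<close> and \<open>Q - 1\<close> have smaller
  2-adic valuation than \<open>r - 1\<close>.
\<close>

locale dickson_frobenius = dickson_alg_closed A t
  for A :: "'a :: alg_closed_field" and t :: nat +
  fixes b :: 'a and Q M1 o1 M2 o2 e1 e2 :: nat
  assumes b: "b ^ 2 = A" and bQ: "b ^ Q = - b"
    and frobQ: "\<And>x y :: 'a. (x + y) ^ Q = x ^ Q + y ^ Q"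
    and odd_Q: "odd Q"
    and M1: "(Q + 1) * M1 = 2 * t * o1" "odd o1"
    and M2: "(Q - 1) * M2 = 2 * t * o2" "odd o2"
    and rQ: "r ^ e1 = Q ^ e2" "odd e1" "even e2"
begin

definition fval :: "'a \<Rightarrow> 'a" where
  "fval c = poly E c ^ (2 * t + 1) / (c ^ 2 - 4 * A) ^ (t * r)"

definition twisted :: "'a \<Rightarrow> 'a \<Rightarrow> 'a \<Rightarrow> bool" where
  "twisted c v l \<longleftrightarrow> v \<noteq> 0 \<and> v ^ r \<noteq> v \<and> c = b * (v ^ (2 * t) + inverse (v ^ (2 * t))) \<and>
     l ^ (2 * t) = - 1 \<and> (v ^ Q = l * v \<or> v ^ Q * v = l)"

lemma b_nz: "b \<noteq> 0" using b A by auto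

lemma twisted_exists:
  assumes c: "c ^ Q = c"
  shows "\<exists>v l. twisted c v l"
proof -
  have "degree [:1, - (c / b), 1:] > 0" by simp
  then obtain y where "poly [:1, - (c / b), 1:] y = 0"
    using alg_closed_imp_poly_has_root by blast
  hence y: "y * y + 1 = c / b * y" by (simp add: algebra_simps eq_neg_iff_add_eq_0)
  hence y_nz: "y \<noteq> 0" by auto
  have cy: "c = b * (y + inverse y)"
    using y y_nz b_nz by (simp add: field_simps)
  have "c ^ Q = - (b * (y ^ Q + inverse y ^ Q))"
    unfolding cy power_mult_distrib frobQ bQ by simp
  hence "b * (y ^ Q + inverse y ^ Q) = - c" using c by simp
  also have "- c = b * (- (y + inverse y))" unfolding cy by (simp only: mult_minus_right)
  finally have "b * (y ^ Q + inverse y ^ Q) = b * (- (y + inverse y))" .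
  hence "y ^ Q + inverse (y ^ Q) = - (y + inverse y)"
    using b_nz by (simp only: mult_left_cancel power_inverse not_False_eq_True)
  moreover have "(z + y) * (z * y + 1) = z * y * ((z + inverse z) + (y + inverse y))"
    if "z \<noteq> 0" for z using that y_nz by (simp add: field_simps)
  ultimately have "(y ^ Q + y) * (y ^ Q * y + 1) = 0" using y_nz by simp
  hence yQ: "y ^ Q = - y \<or> y ^ Q * y = - 1" by (simp add: eq_neg_iff_add_eq_0)
  obtain v where v: "v ^ (2 * t) = y" using nth_root_exists[of "2 * t" y] t by auto
  have v_nz: "v \<noteq> 0" using v y_nz t by auto
  have vQ: "(v ^ Q) ^ (2 * t) = y ^ Q" using v by (metis power_mult mult.commute)
  have "v ^ r \<noteq> v"
  proof
    assume "v ^ r = v"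
    hence "v ^ (4 * t) = 1" using v_nz by simp
    moreover have "v ^ (4 * t) = y ^ 2" unfolding v[symmetric] power_mult[symmetric] by simp
    ultimately have yy: "y = 1 \<or> y = - 1" by (simp add: power2_eq_1_iff)
    hence "y ^ Q = y" using odd_Q by auto
    hence "y = - y" using yQ yy by auto
    thus False using y_nz two by (simp add: eq_neg_iff_add_eq_0 mult_2[symmetric])
  qed
  moreover have "\<exists>l. l ^ (2 * t) = - 1 \<and> (v ^ Q = l * v \<or> v ^ Q * v = l)"
  proof (cases "y ^ Q = - y")
    case True
    have "(v ^ Q / v) ^ (2 * t) = - 1" unfolding power_divide vQ v True using y_nz by simp
    moreover have "v ^ Q = (v ^ Q / v) * v" using v_nz by simp
    ultimately show ?thesis by blast
  next
    case False
    hence "(v ^ Q * v) ^ (2 * t) = - 1" using yQ unfolding power_mult_distrib vQ v by simp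
    thus ?thesis by blast
  qed
  ultimately show ?thesis unfolding twisted_def v cy using v_nz v by metis
qed

lemma power_r: "x ^ r = x * x ^ (4 * t)" for x :: 'a by simp

lemma orbit_invariant:
  fixes v :: 'a
  assumes "v \<noteq> 0" "v ^ r \<noteq> v"
  defines "s \<equiv> v ^ r - v"
  shows "(v ^ (4 * t) - 1) * (s ^ (4 * t) + 1) = v ^ (4 * t) * (v ^ (4 * t)) ^ r - 1"
    and "s * (s ^ (4 * t) + 1) = (v ^ r) ^ r - v"
proof -
  have s_nz: "s \<noteq> 0" using assms(2) by (simp only: s_def right_minus_eq not_False_eq_True)
  have "s ^ r + s = (v ^ r) ^ r - v" unfolding s_def frob_diff by simp
  thus 1: "s * (s ^ (4 * t) + 1) = (v ^ r) ^ r - v"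
    using power_r[of s] by (simp add: distrib_left)
  have "(v ^ r) ^ r = v * (v ^ (4 * t) * (v ^ (4 * t)) ^ r)"
    unfolding power_r[of v] power_mult_distrib by (simp add: mult.assoc)
  hence "v * ((v ^ (4 * t) - 1) * (s ^ (4 * t) + 1)) = v * (v ^ (4 * t) * (v ^ (4 * t)) ^ r - 1)"
    using 1 unfolding s_def power_r[of v] by (simp add: algebra_simps)
  thus "(v ^ (4 * t) - 1) * (s ^ (4 * t) + 1) = v ^ (4 * t) * (v ^ (4 * t)) ^ r - 1"
    using assms(1) by simp
qed

lemma fval_square:
  assumes v: "v \<noteq> 0" "v ^ r \<noteq> v" and c: "c = b * (v ^ (2 * t) + inverse (v ^ (2 * t)))"
  defines "s \<equiv> v ^ r - v"
  shows "fval c ^ 2 = A ^ r * ((s ^ (4 * t) + 1) ^ (r + 1) / (s ^ (4 * t)) ^ r)"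
proof -
  define y z K B where "y = v ^ (2 * t)" and "z = v ^ (4 * t)" and "K = s ^ (4 * t) + 1"
    and "B = s ^ (4 * t)"
  have yz: "y ^ 2 = z" unfolding y_def z_def power_mult[symmetric] by simp
  have nz: "y \<noteq> 0" "z \<noteq> 0" using v by (simp_all add: y_def z_def)
  have z1: "z \<noteq> 1" using v power_r[of v] by (auto simp: z_def)
  have Kz: "(z - 1) * K = z * z ^ r - 1"
    using orbit_invariant(1)[OF v] by (simp add: z_def K_def s_def)
  have s_eq: "s = v * (z - 1)" unfolding s_def power_r[of v] z_def by (simp add: algebra_simps)
  have B_eq: "B = z * (z - 1) ^ (4 * t)" unfolding B_def s_eq power_mult_distrib z_def ..
  have B_nz: "B \<noteq> 0" using z1 nz by (simp add: B_eq)
  have c': "c = b * y + b / y" using c by (simp add: y_def field_simps)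
  have prod: "(b * y) * (b / y) = A" using nz b by (simp add: power2_eq_square)
  have "poly E c * (b * y - b / y) = (b * y) ^ Suc r - (b / y) ^ Suc r"
    using poly_dickson2_functional[of r "b * y" "b / y"] unfolding prod c' .
  hence "poly E c * (b * y - b / y) * (y * y ^ r) = ((b * y) ^ Suc r - (b / y) ^ Suc r) * (y * y ^ r)"
    by simp
  also have "\<dots> = b * b ^ r * ((y * y) * (y * y) ^ r - 1)"
    using nz by (simp add: power_mult_distrib power_divide left_diff_distrib right_diff_distrib)
  also have "y * y = z" using yz by (simp add: power2_eq_square)
  also have "z * z ^ r - 1 = (z - 1) * K" using Kz by simp
  also have "poly E c * (b * y - b / y) * (y * y ^ r) = b * (z - 1) * (poly E c * y ^ r)"
    using nz unfolding yz[symmetric] by (simp add: field_simps power2_eq_square)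
  finally have "b * (z - 1) * (poly E c * y ^ r) = b * (z - 1) * (b ^ r * K)"
    by (simp add: mult_ac)
  moreover have "b * (z - 1) \<noteq> 0" using b_nz z1 by simp
  ultimately have Ec: "poly E c * y ^ r = b ^ r * K"
    by (simp only: mult_left_cancel not_False_eq_True)
  have "(poly E c * y ^ r) ^ 2 = poly E c ^ 2 * (y ^ 2) ^ r"
    by (simp add: power_mult_distrib power_mult[symmetric] mult.commute)
  moreover have "(b ^ r * K) ^ 2 = (b ^ 2) ^ r * K ^ 2"
    by (simp add: power_mult_distrib power_mult[symmetric] mult.commute)
  ultimately have E2: "poly E c ^ 2 = A ^ r * K ^ 2 / z ^ r"
    unfolding Ec b yz using nz by (simp add: field_simps)
  have "c ^ 2 - 4 * A = A * (z - 1) ^ 2 / z"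
  proof -
    have "c ^ 2 = b ^ 2 * (y + 1 / y) ^ 2" by (simp add: c' power2_eq_square algebra_simps)
    also have "(y + 1 / y) ^ 2 = (z + 1) ^ 2 / z"
      using nz unfolding yz[symmetric] by (simp add: power2_eq_square field_simps)
    finally show ?thesis unfolding b using nz by (simp add: field_simps power2_eq_square)
  qed
  hence "(c ^ 2 - 4 * A) ^ (2 * t) = A ^ (2 * t) * ((z - 1) ^ 2) ^ (2 * t) / z ^ (2 * t)"
    by (simp add: power_mult_distrib power_divide)
  also have "((z - 1) ^ 2) ^ (2 * t) = B / z"
    unfolding B_eq power_mult[symmetric] using nz by simp
  finally have D2: "(c ^ 2 - 4 * A) ^ (2 * t) = A ^ (2 * t) * B / z ^ (2 * t + 1)" by simp
  have "fval c ^ 2 = (poly E c ^ 2) ^ (2 * t + 1) / ((c ^ 2 - 4 * A) ^ (2 * t)) ^ r"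
    unfolding fval_def power_divide power_mult[symmetric] by (simp only: ac_simps)
  also have "(poly E c ^ 2) ^ (2 * t + 1) = A ^ (r * (2 * t + 1)) * K ^ (r + 1) / z ^ (r * (2 * t + 1))"
    unfolding E2 power_divide power_mult_distrib power_mult[symmetric] by simp
  also have "((c ^ 2 - 4 * A) ^ (2 * t)) ^ r = A ^ (r * (2 * t)) * B ^ r / z ^ (r * (2 * t + 1))"
    unfolding D2 power_divide power_mult_distrib power_mult[symmetric] by (simp only: ac_simps)
  also have "A ^ (r * (2 * t + 1)) = A ^ r * A ^ (r * (2 * t))"
    unfolding power_add[symmetric] by (simp only: distrib_left mult_1_right add.commute)
  finally have "fval c ^ 2 = A ^ r * (K ^ (r + 1) / B ^ r)" using nz A B_nz
    by (simp add: divide_simps del: power_Suc)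
  thus ?thesis by (simp only: K_def B_def)
qed

lemma linearized_root:
  fixes s v x :: 'a
  assumes s: "s = v ^ r - v" "s \<noteq> 0"
    and root: "(x ^ r) ^ r - (s ^ (4 * t) + 1) * x ^ r + s ^ (4 * t) * x = 0"
  shows "\<exists>\<alpha> \<beta>. \<alpha> ^ r = \<alpha> \<and> \<beta> ^ r = \<beta> \<and> x = \<alpha> * v + \<beta>"
proof -
  define \<psi> where "\<psi> = x ^ r - x"
  define \<alpha> where "\<alpha> = \<psi> / s"
  have "\<psi> ^ r = (x ^ r) ^ r - x ^ r" unfolding \<psi>_def frob_diff ..
  moreover have "u - w = k * (w - x)" if "u - (k + 1) * w + k * x = 0" for u w k :: 'a
    using that by (simp add: algebra_simps)
  ultimately have \<psi>: "\<psi> ^ r = s ^ (4 * t) * \<psi>" using root unfolding \<psi>_def by metis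
  have \<alpha>: "\<alpha> ^ r = \<alpha>" unfolding \<alpha>_def power_divide \<psi> unfolding power_r using s(2) by simp
  have "v ^ r = v + s" using s(1) by simp
  moreover have "\<alpha> * s = \<psi>" using s(2) by (simp add: \<alpha>_def)
  ultimately have "\<alpha> * v ^ r = \<alpha> * v + \<psi>" by (simp only: distrib_left)
  hence "(x - \<alpha> * v) ^ r = x - \<alpha> * v"
    unfolding frob_diff power_mult_distrib \<alpha> by (simp add: \<psi>_def)
  thus ?thesis using \<alpha> by (intro exI[of _ \<alpha>] exI[of _ "x - \<alpha> * v"]) simp
qed

text \<open>
  The polynomial \<open>X\<^bsup>r\<^sup>2\<^esup> - (s\<^bsup>r-1\<^esup> + 1) X\<^sup>r + s\<^bsup>r-1\<^esup> X\<close> has the \<open>F\<^sub>r\<close>-span of \<open>1\<close> and \<open>v\<close> as its set of roots. Equal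
  invariants make the polynomials of \<open>v\<close> and \<open>w\<close> proportional after a scaling \<open>X \<mapsto> \<kappa>X\<close>, so the two
  spans are homothetic.
\<close>

lemma orbit_mobius:
  fixes v w :: 'a
  assumes v: "v ^ r \<noteq> v" and w: "w ^ r \<noteq> w"
  defines "s \<equiv> v ^ r - v" and "u \<equiv> w ^ r - w"
  assumes K: "s ^ (4 * t) + 1 \<noteq> 0" "u ^ (4 * t) + 1 \<noteq> 0"
    and eq: "(s ^ (4 * t) + 1) ^ (r + 1) / (s ^ (4 * t)) ^ r =
             (u ^ (4 * t) + 1) ^ (r + 1) / (u ^ (4 * t)) ^ r"
  shows "\<exists>\<alpha> \<beta> \<gamma> \<delta>. \<alpha> ^ r = \<alpha> \<and> \<beta> ^ r = \<beta> \<and> \<gamma> ^ r = \<gamma> \<and> \<delta> ^ r = \<delta> \<and>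
           \<gamma> * v + \<delta> \<noteq> 0 \<and> w * (\<gamma> * v + \<delta>) = \<alpha> * v + \<beta>"
proof -
  have su: "s \<noteq> 0" "u \<noteq> 0"
    using v w by (simp_all only: s_def u_def right_minus_eq not_False_eq_True)
  define B B' K K' where "B = s ^ (4 * t)" and "B' = u ^ (4 * t)" and "K = B + 1" and "K' = B' + 1"
  have nz: "B \<noteq> 0" "B' \<noteq> 0" "K \<noteq> 0" "K' \<noteq> 0"
    using su assms(5,6) by (simp_all add: B_def B'_def K_def K'_def)
  define \<rho> \<theta> where "\<rho> = K' / K" and "\<theta> = B' / B"
  have \<rho>: "\<rho> \<noteq> 0" "K' = \<rho> * K" and \<theta>: "B' = \<theta> * B" using nz by (simp_all add: \<rho>_def \<theta>_def)
  have "K ^ (r + 1) / B ^ r = K' ^ (r + 1) / B' ^ r"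
    using eq by (simp only: B_def B'_def K_def K'_def)
  hence "\<theta> ^ r = \<rho> ^ (r + 1)" using nz unfolding \<theta>_def \<rho>_def power_divide
    by (simp only: frac_eq_eq power_not_zero not_False_eq_True mult.commute)
  define \<tau> where "\<tau> = \<theta> / \<rho>"
  have \<tau>r: "\<tau> ^ r = \<rho>" unfolding \<tau>_def power_divide \<open>\<theta> ^ r = _\<close> using \<rho> by simp
  obtain \<kappa> where \<kappa>: "\<kappa> ^ (4 * t) = \<tau>" using nth_root_exists[of "4 * t" \<tau>] t by auto
  have \<kappa>_nz: "\<kappa> \<noteq> 0" using \<kappa> \<tau>r \<rho> t by auto
  have \<kappa>r: "\<kappa> ^ r = \<kappa> * \<tau>" unfolding power_r \<kappa> ..
  have 1: "(\<kappa> ^ r) ^ r = \<rho> * \<kappa> ^ r"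
  proof -
    have "(\<kappa> ^ r) ^ r = (\<kappa> * \<tau>) ^ r" by (simp only: \<kappa>r)
    also have "\<dots> = \<kappa> ^ r * \<rho>" by (simp only: power_mult_distrib \<tau>r)
    finally show ?thesis by (simp only: mult.commute)
  qed
  have 2: "(\<kappa> ^ r) ^ r = \<theta> * \<kappa>" unfolding 1 unfolding \<kappa>r using \<rho> by (simp add: \<tau>_def)
  have scale: "\<exists>\<alpha> \<beta>. \<alpha> ^ r = \<alpha> \<and> \<beta> ^ r = \<beta> \<and> x / \<kappa> = \<alpha> * v + \<beta>"
    if "(x ^ r) ^ r - K' * x ^ r + B' * x = 0" for x
  proof (rule linearized_root)
    define z where "z = x / \<kappa>"
    have x: "x = \<kappa> * z" using \<kappa>_nz by (simp add: z_def)
    have "0 = (\<kappa> ^ r) ^ r * (z ^ r) ^ r - (\<rho> * \<kappa> ^ r) * (K * z ^ r) + (\<theta> * \<kappa>) * (B * z)"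
      using that unfolding x \<rho>(2) \<theta> power_mult_distrib by (simp only: mult_ac)
    also have "\<dots> = (\<kappa> ^ r) ^ r * ((z ^ r) ^ r - K * z ^ r + B * z)"
      unfolding 1[symmetric] 2[symmetric] by (simp only: right_diff_distrib distrib_left)
    finally have "(z ^ r) ^ r - K * z ^ r + B * z = 0" using \<kappa>_nz
      by (metis mult_eq_0_iff power_eq_0_iff)
    thus "(z ^ r) ^ r - (s ^ (4 * t) + 1) * z ^ r + s ^ (4 * t) * z = 0"
      by (simp only: B_def K_def)
  qed (use s_def su in simp_all)
  have "(1 ^ r) ^ r - K' * 1 ^ r + B' * 1 = 0" by (simp add: K'_def)
  from scale[OF this] obtain \<gamma> \<delta> where \<gamma>\<delta>: "\<gamma> ^ r = \<gamma>" "\<delta> ^ r = \<delta>" "1 / \<kappa> = \<gamma> * v + \<delta>" by blast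
  have wr: "w ^ r = w + u" by (simp add: u_def)
  have ur: "u ^ r = B' * u" by (simp add: power_r B'_def)
  have "(w ^ r) ^ r - K' * w ^ r + B' * w = 0"
    unfolding wr frob ur by (simp add: K'_def algebra_simps)
  from scale[OF this] obtain \<alpha> \<beta> where \<alpha>\<beta>: "\<alpha> ^ r = \<alpha>" "\<beta> ^ r = \<beta>" "w / \<kappa> = \<alpha> * v + \<beta>" by blast
  have "w * (\<gamma> * v + \<delta>) = \<alpha> * v + \<beta>" unfolding \<gamma>\<delta>(3)[symmetric] \<alpha>\<beta>(3)[symmetric] by simp
  moreover have "\<gamma> * v + \<delta> \<noteq> 0" unfolding \<gamma>\<delta>(3)[symmetric] using \<kappa>_nz by simp
  ultimately show ?thesis using \<gamma>\<delta> \<alpha>\<beta> by blast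
qed

lemma no_quadratic:
  fixes p q v w :: 'a
  assumes v: "v ^ r \<noteq> v" "(v ^ r) ^ r \<noteq> v"
    and F: "p ^ r = p" "q ^ r = q" "w ^ r = w" and eq: "p * v ^ 2 + q * v + w = 0"
  shows "p = 0 \<and> q = 0 \<and> w = 0"
proof -
  define u where "u = v ^ r"
  have "(p * v ^ 2 + q * v + w) ^ r = 0" unfolding eq by simp
  moreover have "(v ^ 2) ^ r = u ^ 2" unfolding u_def by (metis power_mult mult.commute)
  ultimately have "p * u ^ 2 + q * u + w = 0"
    unfolding frob power_mult_distrib F by (simp only: u_def)
  moreover have "(u - v) * (p * (u + v) + q) = (p * u ^ 2 + q * u + w) - (p * v ^ 2 + q * v + w)"
    by (simp add: algebra_simps power2_eq_square)
  ultimately have "(u - v) * (p * (u + v) + q) = 0" using eq by simp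
  hence 1: "p * (u + v) + q = 0" using v by (simp add: u_def)
  hence "(p * (u + v) + q) ^ r = 0" by simp
  hence "p * (u ^ r + u) + q = 0" unfolding frob power_mult_distrib F by (simp add: u_def)
  moreover have "p * (z - v) = (p * (z + u) + q) - (p * (u + v) + q)" for z
    by (simp add: algebra_simps)
  from this[of "u ^ r"] have "p * (u ^ r - v) = (p * (u ^ r + u) + q) - (p * (u + v) + q)" .
  ultimately have "p * (u ^ r - v) = 0" using 1 by (simp only: diff_self)
  hence p: "p = 0" using v by (simp add: u_def)
  with 1 have "q = 0" by simp
  with p eq show ?thesis by simp
qed

lemma neg_one_neq_one: "(- 1 :: 'a) \<noteq> 1"
  using two by (metis add.right_inverse one_add_one)

lemma F_power: "x ^ (4 * t) = 1" if "x ^ r = x" "x \<noteq> 0" for x :: 'a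
  using that by simp

lemma F_root_sign: "x ^ (2 * t) = 1 \<or> x ^ (2 * t) = - 1" if "x ^ r = x" "x \<noteq> 0" for x :: 'a
proof -
  have "(x ^ (2 * t)) ^ 2 = x ^ (4 * t)" unfolding power_mult[symmetric] by simp
  thus ?thesis using F_power[OF that] by (simp add: power2_eq_1_iff)
qed

lemma nonsquare_quotient:
  fixes l x :: 'a
  assumes "l ^ (2 * t) = - 1" "x ^ r = x" "x \<noteq> 0"
  shows "x ^ Q \<noteq> l * x" and "x ^ Q * x \<noteq> l"
proof -
  have c: "(x ^ Q) ^ (2 * t) = (x ^ (2 * t)) ^ Q" by (metis power_mult mult.commute)
  have e: "(x ^ (2 * t)) ^ Q = x ^ (2 * t)" using F_root_sign[OF assms(2,3)] odd_Q by auto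
  show "x ^ Q \<noteq> l * x"
  proof
    assume "x ^ Q = l * x"
    hence "(x ^ Q) ^ (2 * t) = - (x ^ (2 * t))" by (simp add: power_mult_distrib assms(1))
    hence "1 = (- 1 :: 'a)" unfolding c e using F_root_sign[OF assms(2,3)] assms(3) by auto
    thus False using neg_one_neq_one by simp
  qed
  show "x ^ Q * x \<noteq> l"
  proof
    assume "x ^ Q * x = l"
    hence "(x ^ Q) ^ (2 * t) * x ^ (2 * t) = - 1" using assms(1) by (metis power_mult_distrib)
    hence "1 = (- 1 :: 'a)" unfolding c e using F_root_sign[OF assms(2,3)] assms(3) by auto
    thus False using neg_one_neq_one by simp
  qed
qed

lemma Q_ge: "Q \<ge> 1" using odd_Q by (cases Q) auto

lemma QQ: "Q * Q = (Q - 1) * (Q + 1) + 1"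
  using Q_ge by (cases Q) auto

lemma twisted_swap:
  fixes l w x :: 'a
  assumes l: "l ^ (2 * t) = - 1" and w: "w ^ r = w" "w \<noteq> 0"
  shows "\<not> (l * x = w ^ Q \<and> l * w = x ^ Q)" and "\<not> (x * w ^ Q = l \<and> x ^ Q * w = l)"
proof -
  have l_nz: "l \<noteq> 0" using l t by (cases "l = 0") (auto simp: power_0_left)
  have F: "w ^ (4 * t * k) = 1" for k using F_power[OF w] by (simp add: power_mult)
  have lo: "l ^ (2 * t * o') = - 1" if "odd o'" for o' using l that by (simp add: power_mult)
  show "\<not> (l * x = w ^ Q \<and> l * w = x ^ Q)"
  proof
    assume a: "l * x = w ^ Q \<and> l * w = x ^ Q"
    have "w ^ (Q * Q) = l ^ Q * x ^ Q" using a by (metis power_mult power_mult_distrib)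
    also have "\<dots> = l ^ (Q + 1) * w" using a by (simp flip: mult.assoc)
    finally have "w ^ ((Q - 1) * (Q + 1)) = l ^ (Q + 1)" unfolding QQ using w(2) by simp
    hence "w ^ ((Q - 1) * (Q + 1) * M1) = l ^ ((Q + 1) * M1)" by (metis power_mult)
    moreover have "(Q - 1) * (Q + 1) * M1 = (Q - 1) * (2 * t * o1)"
      unfolding M1(1)[symmetric] by (simp only: mult.assoc)
    ultimately have "w ^ ((Q - 1) * (2 * t * o1)) = - 1" unfolding M1(1) lo[OF M1(2)] by simp
    moreover obtain h where "Q = 2 * h + 1" using odd_Q by (elim oddE)
    hence "(Q - 1) * (2 * t * o1) = 4 * t * (h * o1)" by simp
    ultimately show False using F[of "h * o1"] neg_one_neq_one by metis
  qed
  show "\<not> (x * w ^ Q = l \<and> x ^ Q * w = l)"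
  proof
    assume a: "x * w ^ Q = l \<and> x ^ Q * w = l"
    have "l ^ Q = x ^ Q * w ^ (Q * Q)" using a by (metis power_mult power_mult_distrib)
    also have "\<dots> = (x ^ Q * w) * w ^ ((Q - 1) * (Q + 1))" unfolding QQ by simp
    also have "\<dots> = l * w ^ ((Q - 1) * (Q + 1))" using a by simp
    also have "l ^ Q = l * l ^ (Q - 1)" using Q_ge by (cases Q) auto
    finally have "w ^ ((Q - 1) * (Q + 1)) = l ^ (Q - 1)" using l_nz by simp
    hence "w ^ ((Q - 1) * (Q + 1) * M2) = l ^ ((Q - 1) * M2)" by (metis power_mult)
    moreover have "(Q - 1) * (Q + 1) * M2 = (Q + 1) * (2 * t * o2)"
      unfolding M2(1)[symmetric] by (simp only: ac_simps)
    ultimately have "w ^ ((Q + 1) * (2 * t * o2)) = - 1" unfolding M2(1) lo[OF M2(2)] by simp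
    moreover obtain h where "Q = 2 * h + 1" using odd_Q by (elim oddE)
    hence "(Q + 1) * (2 * t * o2) = 4 * t * ((h + 1) * o2)" by (simp add: algebra_simps)
    ultimately show False using F[of "(h + 1) * o2"] neg_one_neq_one by metis
  qed
qed

definition F :: "'a set" where "F = {x. x ^ r = x}"

lemma F_closed:
  shows "x \<in> F \<Longrightarrow> y \<in> F \<Longrightarrow> x + y \<in> F"
    and "x \<in> F \<Longrightarrow> y \<in> F \<Longrightarrow> x - y \<in> F"
    and "x \<in> F \<Longrightarrow> y \<in> F \<Longrightarrow> x * y \<in> F"
    and "x \<in> F \<Longrightarrow> y \<in> F \<Longrightarrow> x / y \<in> F"
    and "x \<in> F \<Longrightarrow> x ^ n \<in> F"
proof -
  have "(x ^ n) ^ r = (x ^ r) ^ n" by (metis power_mult mult.commute)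
  thus "x \<in> F \<Longrightarrow> x ^ n \<in> F" by (simp only: F_def mem_Collect_eq)
qed (simp_all only: F_def mem_Collect_eq frob frob_diff power_mult_distrib power_divide)

lemma twisted_factor_F: "l \<in> F" if "l ^ (2 * t) = - 1"
proof -
  have "l ^ r = l * (l ^ (2 * t)) ^ 2" unfolding power_r power_mult[symmetric] by simp
  thus ?thesis unfolding that by (simp add: F_def)
qed

lemma nonsquare_ratio:
  assumes "l ^ (2 * t) = - 1" "x \<in> F" "y \<in> F" "x \<noteq> 0" "y \<noteq> 0"
  shows "x ^ Q * y \<noteq> l * (x * y ^ Q)" and "x ^ Q * x \<noteq> l * (y ^ Q * y)"
proof -
  have xy: "(x / y) ^ r = x / y" "x / y \<noteq> 0"
    using F_closed(4)[OF assms(2,3)] assms(4,5) by (simp_all add: F_def)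
  show "x ^ Q * y \<noteq> l * (x * y ^ Q)"
    using nonsquare_quotient(1)[OF assms(1) xy] assms(4,5)
    by (simp add: power_divide field_simps)
  show "x ^ Q * x \<noteq> l * (y ^ Q * y)"
    using nonsquare_quotient(2)[OF assms(1) xy] assms(4,5)
    by (simp add: power_divide field_simps)
qed

lemma twisted_ratio:
  assumes l: "l ^ (2 * t) = - 1" and F: "\<alpha> \<in> F" "\<beta> \<in> F" "\<gamma> \<in> F" "\<delta> \<in> F"
    and nz: "\<alpha> \<noteq> 0" "\<beta> \<noteq> 0" "\<gamma> \<noteq> 0" "\<delta> \<noteq> 0"
  shows "\<not> (l * (\<alpha> * \<delta> ^ Q) = \<beta> ^ Q * \<gamma> \<and> l * (\<beta> * \<gamma> ^ Q) = \<alpha> ^ Q * \<delta>)"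
    and "\<not> (l * (\<gamma> * \<delta> ^ Q) = \<alpha> * \<beta> ^ Q \<and> l * (\<delta> * \<gamma> ^ Q) = \<alpha> ^ Q * \<beta>)"
proof -
  have w: "(\<beta> / \<delta>) ^ r = \<beta> / \<delta>" "\<beta> / \<delta> \<noteq> 0"
    using F_closed(4)[OF F(2,4)] nz by (simp_all add: F_def)
  show "\<not> (l * (\<alpha> * \<delta> ^ Q) = \<beta> ^ Q * \<gamma> \<and> l * (\<beta> * \<gamma> ^ Q) = \<alpha> ^ Q * \<delta>)"
  proof (intro notI, elim conjE)
    assume a: "l * (\<alpha> * \<delta> ^ Q) = \<beta> ^ Q * \<gamma>" "l * (\<beta> * \<gamma> ^ Q) = \<alpha> ^ Q * \<delta>"
    have "l * (\<alpha> / \<gamma>) = (\<beta> / \<delta>) ^ Q" unfolding times_divide_eq_right power_divide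
      by (subst frac_eq_eq) (simp_all add: nz a mult.assoc)
    moreover have "l * (\<beta> / \<delta>) = (\<alpha> / \<gamma>) ^ Q" unfolding times_divide_eq_right power_divide
      by (subst frac_eq_eq) (simp_all add: nz a mult.assoc)
    ultimately show False using twisted_swap(1)[OF l w, of "\<alpha> / \<gamma>"] by blast
  qed
  show "\<not> (l * (\<gamma> * \<delta> ^ Q) = \<alpha> * \<beta> ^ Q \<and> l * (\<delta> * \<gamma> ^ Q) = \<alpha> ^ Q * \<beta>)"
  proof (intro notI, elim conjE)
    assume a: "l * (\<gamma> * \<delta> ^ Q) = \<alpha> * \<beta> ^ Q" "l * (\<delta> * \<gamma> ^ Q) = \<alpha> ^ Q * \<beta>"
    have "\<alpha> / \<gamma> * (\<beta> / \<delta>) ^ Q = l" unfolding power_divide times_divide_times_eq a(1)[symmetric]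
      using nz by simp
    moreover have "(\<alpha> / \<gamma>) ^ Q * (\<beta> / \<delta>) = l" unfolding power_divide times_divide_times_eq a(2)[symmetric]
      using nz by simp
    ultimately show False using twisted_swap(2)[OF l w, of "\<alpha> / \<gamma>"] by blast
  qed
qed

lemma mobius_monomial:
  assumes v: "twisted c v l" and w: "twisted c' w l'"
    and v2: "(v ^ r) ^ r \<noteq> v"
    and F: "\<alpha> \<in> F" "\<beta> \<in> F" "\<gamma> \<in> F" "\<delta> \<in> F"
    and mob: "\<gamma> * v + \<delta> \<noteq> 0" "w * (\<gamma> * v + \<delta>) = \<alpha> * v + \<beta>"
  shows "\<alpha> = 0 \<and> \<delta> = 0 \<or> \<beta> = 0 \<and> \<gamma> = 0"
proof -
  have v': "v \<noteq> 0" "v ^ r \<noteq> v" "l ^ (2 * t) = - 1" and w': "w \<noteq> 0" "w ^ r \<noteq> w"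
    and l': "l' ^ (2 * t) = - 1"
    and vl: "v ^ Q = l * v \<or> v ^ Q * v = l" and wl: "w ^ Q = l' * w \<or> w ^ Q * w = l'"
    using v w unfolding twisted_def by blast+
  have l: "l \<in> F" "l' \<in> F" using v'(3) l' by (blast intro: twisted_factor_F)+
  have l_nz: "l \<noteq> 0" using v'(3) t by (auto simp: power_0_left)
  have l'_nz: "l' \<noteq> 0" using l' t by (auto simp: power_0_left)
  have quad: "p = 0 \<and> s = 0" if "p \<in> F" "q \<in> F" "s \<in> F" "p * v ^ 2 + q * v + s = 0" for p q s
    using no_quadratic[of v p q s] v'(2) v2 that unfolding F_def mem_Collect_eq by blast
  have notF: "x * w \<noteq> y" if "x \<in> F" "y \<in> F" "x \<noteq> 0" for x y
  proof
    assume "x * w = y"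
    hence "w = y / x" using that by (simp add: field_simps)
    hence "w \<in> F" using F_closed(4) that by simp
    thus False using w'(2) by (simp only: F_def mem_Collect_eq)
  qed
  have nd1: "\<not> (\<alpha> = 0 \<and> \<gamma> = 0)" using mob notF[OF F(4,2)] by (auto simp: mult.commute)
  have nd2: "\<not> (\<beta> = 0 \<and> \<delta> = 0)" using mob notF[OF F(3,1)] v'(1) by (auto simp: mult.commute)
  have nd3: "\<not> (\<alpha> = 0 \<and> \<beta> = 0)" using mob w'(1) by auto
  have nd4: "\<not> (\<gamma> = 0 \<and> \<delta> = 0)" using mob by auto
  define a b1 g d where "a = \<alpha> ^ Q" and "b1 = \<beta> ^ Q" and "g = \<gamma> ^ Q" and "d = \<delta> ^ Q"
  have FQ: "a \<in> F" "b1 \<in> F" "g \<in> F" "d \<in> F" unfolding a_def b1_def g_def d_def by (intro F_closed F)+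
  have Q0: "Q > 0" using odd_Q by (cases Q) auto
  have z: "a = 0 \<longleftrightarrow> \<alpha> = 0" "b1 = 0 \<longleftrightarrow> \<beta> = 0" "g = 0 \<longleftrightarrow> \<gamma> = 0" "d = 0 \<longleftrightarrow> \<delta> = 0"
    using Q0 by (simp_all add: a_def b1_def g_def d_def)
  have Qeq: "w ^ Q * (g * v ^ Q + d) = a * v ^ Q + b1"
    using arg_cong[OF mob(2), of "\<lambda>x. x ^ Q"]
    by (simp only: power_mult_distrib frobQ a_def b1_def g_def d_def)
  note Fs = F FQ l
  from vl wl show ?thesis
  proof (elim disjE)
    assume 1: "v ^ Q = l * v" "w ^ Q = l' * w"
    have "l' * (w * (\<gamma> * v + \<delta>)) * (g * (l * v) + d) = (\<gamma> * v + \<delta>) * (a * (l * v) + b1)"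
      using Qeq unfolding 1 by (metis mult.assoc mult.commute)
    hence "(l' * \<alpha> * g * l - a * l * \<gamma>) * v ^ 2 +
        (l' * \<alpha> * d + l' * \<beta> * g * l - a * l * \<delta> - b1 * \<gamma>) * v + (l' * \<beta> * d - b1 * \<delta>) = 0"
      unfolding mob(2) by (simp add: algebra_simps power2_eq_square)
    hence "l' * \<alpha> * g * l - a * l * \<gamma> = 0 \<and> l' * \<beta> * d - b1 * \<delta> = 0"
      by (rule quad[rotated 3]) (assumption | intro F_closed Fs)+
    hence e: "a * \<gamma> = l' * (\<alpha> * g)" "b1 * \<delta> = l' * (\<beta> * d)"
      using l_nz by (auto simp: algebra_simps)
    have "\<alpha> = 0 \<or> \<gamma> = 0"
      using nonsquare_ratio(1)[OF l' F(1,3)] e(1) unfolding a_def g_def by blast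
    moreover have "\<beta> = 0 \<or> \<delta> = 0"
      using nonsquare_ratio(1)[OF l' F(2,4)] e(2) unfolding b1_def d_def by blast
    ultimately show ?thesis using nd1 nd2 nd3 nd4 by blast
  next
    assume 1: "v ^ Q * v = l" "w ^ Q = l' * w"
    have "w ^ Q * (\<gamma> * v + \<delta>) * ((g * v ^ Q + d) * v) = (\<gamma> * v + \<delta>) * ((a * v ^ Q + b1) * v)"
      using Qeq by (metis mult.assoc mult.commute)
    moreover have "(g * v ^ Q + d) * v = g * l + d * v" "(a * v ^ Q + b1) * v = a * l + b1 * v"
      unfolding 1(1)[symmetric] by (simp_all add: algebra_simps)
    moreover have "w ^ Q * (\<gamma> * v + \<delta>) = l' * (\<alpha> * v + \<beta>)"
      unfolding 1(2) mob(2)[symmetric] by (simp only: mult.assoc)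
    ultimately have "l' * (\<alpha> * v + \<beta>) * (g * l + d * v) = (\<gamma> * v + \<delta>) * (a * l + b1 * v)" by simp
    hence "(l' * \<alpha> * d - b1 * \<gamma>) * v ^ 2 +
        (l' * \<alpha> * g * l + l' * \<beta> * d - a * l * \<gamma> - b1 * \<delta>) * v + (l' * \<beta> * g * l - a * l * \<delta>) = 0"
      by (simp add: algebra_simps power2_eq_square)
    hence "l' * \<alpha> * d - b1 * \<gamma> = 0 \<and> l' * \<beta> * g * l - a * l * \<delta> = 0"
      by (rule quad[rotated 3]) (assumption | intro F_closed Fs)+
    hence e: "l' * (\<alpha> * d) = b1 * \<gamma>" "l' * (\<beta> * g) = a * \<delta>"
      using l_nz by (auto simp: algebra_simps)
    have "\<alpha> = 0 \<or> \<beta> = 0 \<or> \<gamma> = 0 \<or> \<delta> = 0"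
      using twisted_ratio(1)[OF l' F] e unfolding a_def b1_def g_def d_def by blast
    moreover have "l' * (\<alpha> * d) = 0 \<longleftrightarrow> b1 * \<gamma> = 0" by (simp only: e(1))
    hence "\<alpha> = 0 \<or> \<delta> = 0 \<longleftrightarrow> \<beta> = 0 \<or> \<gamma> = 0"
      using l'_nz z unfolding mult_eq_0_iff by blast
    ultimately show ?thesis using nd1 nd2 nd3 nd4 by blast
  next
    assume 1: "v ^ Q = l * v" "w ^ Q * w = l'"
    have "(w ^ Q * w) * (\<gamma> * v + \<delta>) * (g * v ^ Q + d) =
        (w * (\<gamma> * v + \<delta>)) * (w ^ Q * (g * v ^ Q + d))" by (simp only: mult_ac)
    hence "l' * (\<gamma> * v + \<delta>) * (g * (l * v) + d) = (\<alpha> * v + \<beta>) * (a * (l * v) + b1)"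
      unfolding Qeq mob(2) unfolding 1 .
    hence "(l' * \<gamma> * g * l - a * l * \<alpha>) * v ^ 2 +
        (l' * \<gamma> * d + l' * \<delta> * g * l - a * l * \<beta> - b1 * \<alpha>) * v + (l' * \<delta> * d - b1 * \<beta>) = 0"
      by (simp add: algebra_simps power2_eq_square)
    hence "l' * \<gamma> * g * l - a * l * \<alpha> = 0 \<and> l' * \<delta> * d - b1 * \<beta> = 0"
      by (rule quad[rotated 3]) (assumption | intro F_closed Fs)+
    hence e: "a * \<alpha> = l' * (g * \<gamma>)" using l_nz by (auto simp: algebra_simps)
    have "\<alpha> = 0 \<or> \<gamma> = 0"
      using nonsquare_ratio(2)[OF l' F(1,3)] e unfolding a_def g_def by blast
    moreover have "a * \<alpha> = 0 \<longleftrightarrow> l' * (g * \<gamma>) = 0" by (simp only: e)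
    ultimately have "\<alpha> = 0 \<and> \<gamma> = 0" using l'_nz z unfolding mult_eq_0_iff by blast
    thus ?thesis using nd1 by blast
  next
    assume 1: "v ^ Q * v = l" "w ^ Q * w = l'"
    have "(w ^ Q * w) * (\<gamma> * v + \<delta>) * ((g * v ^ Q + d) * v) =
        (w * (\<gamma> * v + \<delta>)) * ((w ^ Q * (g * v ^ Q + d)) * v)" by (simp only: mult_ac)
    hence "l' * (\<gamma> * v + \<delta>) * ((g * v ^ Q + d) * v) = (\<alpha> * v + \<beta>) * ((a * v ^ Q + b1) * v)"
      unfolding Qeq mob(2) unfolding 1(2) .
    moreover have "(g * v ^ Q + d) * v = g * l + d * v" "(a * v ^ Q + b1) * v = a * l + b1 * v"
      unfolding 1(1)[symmetric] by (simp_all add: algebra_simps)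
    ultimately have "l' * (\<gamma> * v + \<delta>) * (g * l + d * v) = (\<alpha> * v + \<beta>) * (a * l + b1 * v)" by simp
    hence "(l' * \<gamma> * d - b1 * \<alpha>) * v ^ 2 +
        (l' * \<gamma> * g * l + l' * \<delta> * d - a * l * \<alpha> - b1 * \<beta>) * v + (l' * \<delta> * g * l - a * l * \<beta>) = 0"
      by (simp add: algebra_simps power2_eq_square)
    hence "l' * \<gamma> * d - b1 * \<alpha> = 0 \<and> l' * \<delta> * g * l - a * l * \<beta> = 0"
      by (rule quad[rotated 3]) (assumption | intro F_closed Fs)+
    hence e: "l' * (\<gamma> * d) = \<alpha> * b1" "l' * (\<delta> * g) = a * \<beta>"
      using l_nz by (auto simp: algebra_simps)
    have "\<alpha> = 0 \<or> \<beta> = 0 \<or> \<gamma> = 0 \<or> \<delta> = 0"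
      using twisted_ratio(2)[OF l' F] e unfolding a_def b1_def g_def d_def by blast
    moreover have "l' * (\<gamma> * d) = 0 \<longleftrightarrow> \<alpha> * b1 = 0" by (simp only: e(1))
    hence "\<gamma> = 0 \<or> \<delta> = 0 \<longleftrightarrow> \<alpha> = 0 \<or> \<beta> = 0"
      using l'_nz z unfolding mult_eq_0_iff by blast
    ultimately show ?thesis using nd1 nd2 nd3 nd4 by blast
  qed
qed

lemma twisted_zero:
  assumes v: "twisted c v l" and K: "(v ^ r) ^ r = v"
  shows "c = 0"
proof -
  note v' = v[unfolded twisted_def]
  define z where "z = v ^ (4 * t)"
  have z_nz: "z \<noteq> 0" using v' by (simp add: z_def)
  have vr: "v ^ r = v * z" by (simp add: z_def)
  have "v * (z * z ^ r) = v" using K unfolding vr power_mult_distrib by (simp only: mult.assoc)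
  hence zr: "z * z ^ r = 1" using v' by simp
  have "l ^ (4 * t) = (l ^ (2 * t)) ^ 2" unfolding power_mult[symmetric] by simp
  hence l4: "l ^ (4 * t) = 1" using v' by simp
  have "(v ^ Q) ^ (4 * t) = z ^ Q" unfolding z_def by (metis power_mult mult.commute)
  hence "z ^ Q = z \<or> z ^ Q * z = 1"
    using v' l4 z_def by (metis mult_1 power_mult_distrib)
  hence zQQ: "z ^ (Q * Q) = z"
  proof
    assume "z ^ Q = z" thus ?thesis by (simp add: power_mult)
  next
    assume "z ^ Q * z = 1"
    hence "z ^ Q = inverse z" using z_nz by (simp add: field_simps)
    thus ?thesis by (simp add: power_mult power_inverse)
  qed
  have fixp: "z ^ (N ^ k) = z" if "z ^ N = z" for N k
    by (induction k) (simp_all add: power_mult that)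
  obtain h where "e2 = 2 * h" using rQ(3) by (elim evenE)
  hence "Q ^ e2 = (Q * Q) ^ h" by (simp add: power_mult power2_eq_square)
  hence 1: "z ^ (r ^ e1) = z" using fixp[OF zQQ] rQ(1) by simp
  have zr': "z ^ r = inverse z" using zr z_nz by (simp add: field_simps)
  have "z ^ (r * r) = inverse (z ^ r)" unfolding power_mult zr' unfolding power_inverse zr' ..
  hence zrr: "z ^ (r * r) = z" unfolding zr' by simp
  obtain j where "e1 = 2 * j + 1" using rQ(2) by (elim oddE)
  hence "r ^ e1 = (r * r) ^ j * r" by (simp add: power_mult power2_eq_square)
  hence "z ^ (r ^ e1) = inverse z" using fixp[OF zrr] zr' by (simp only: power_mult)
  hence "z * z = 1" using 1 z_nz by (metis right_inverse)
  moreover have "z \<noteq> 1" using v' vr by auto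
  ultimately have "z = - 1" by (metis power2_eq_1_iff power2_eq_square)
  moreover have "z = v ^ (2 * t) * v ^ (2 * t)" unfolding z_def power_add[symmetric] by simp
  ultimately have "v ^ (2 * t) + inverse (v ^ (2 * t)) = 0"
    using v' by (simp add: field_simps eq_neg_iff_add_eq_0)
  thus ?thesis using v' by simp
qed

lemma poly_dickson2_minus: "poly E (- x) = - poly E x"
proof -
  have "2 * poly E (- x) = 2 * (- poly E x)"
    using poly_dickson2_closed_form[of x] poly_dickson2_closed_form[of "- x"] power_minus_odd[of r x]
    by simp
  thus ?thesis using two by (simp only: mult_left_cancel not_False_eq_True)
qed

lemma fval_minus: "fval (- c) = - fval c"
  unfolding fval_def poly_dickson2_minus by simp

theorem fval_inj:
  assumes c: "c ^ Q = c" "c' ^ Q = c'" and eq: "fval c = fval c'"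
  shows "c = c'"
proof -
  obtain v l where v: "twisted c v l" using twisted_exists c by blast
  obtain w l' where w: "twisted c' w l'" using twisted_exists c by blast
  note v' = v[unfolded twisted_def] and w' = w[unfolded twisted_def]
  define s u where "s = v ^ r - v" and "u = w ^ r - w"
  have su: "s \<noteq> 0" "u \<noteq> 0" using v' w' by (simp_all only: s_def u_def right_minus_eq not_False_eq_True)
  have fv: "fval c ^ 2 = A ^ r * ((s ^ (4 * t) + 1) ^ (r + 1) / (s ^ (4 * t)) ^ r)"
    unfolding s_def by (rule fval_square) (use v' in blast)+
  have fw: "fval c' ^ 2 = A ^ r * ((u ^ (4 * t) + 1) ^ (r + 1) / (u ^ (4 * t)) ^ r)"
    unfolding u_def by (rule fval_square) (use w' in blast)+
  have Kv: "s ^ (4 * t) + 1 = 0 \<longleftrightarrow> (v ^ r) ^ r = v"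
    using orbit_invariant(2)[of v] su(1) v' unfolding s_def[symmetric]
    by (metis mult_eq_0_iff right_minus_eq)
  have Kw: "u ^ (4 * t) + 1 = 0 \<longleftrightarrow> (w ^ r) ^ r = w"
    using orbit_invariant(2)[of w] su(2) w' unfolding u_def[symmetric]
    by (metis mult_eq_0_iff right_minus_eq)
  have zv: "fval c = 0 \<longleftrightarrow> s ^ (4 * t) + 1 = 0"
  proof -
    have "fval c = 0 \<longleftrightarrow> fval c ^ 2 = 0" by simp
    also have "\<dots> \<longleftrightarrow> s ^ (4 * t) + 1 = 0" unfolding fv using A su by (simp del: power_Suc)
    finally show ?thesis .
  qed
  have zw: "fval c' = 0 \<longleftrightarrow> u ^ (4 * t) + 1 = 0"
  proof -
    have "fval c' = 0 \<longleftrightarrow> fval c' ^ 2 = 0" by simp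
    also have "\<dots> \<longleftrightarrow> u ^ (4 * t) + 1 = 0" unfolding fw using A su by (simp del: power_Suc)
    finally show ?thesis .
  qed
  show ?thesis
  proof (cases "fval c = 0")
    case True
    hence "c = 0" "c' = 0" using twisted_zero v w Kv Kw zv zw eq by metis+
    thus ?thesis by simp
  next
    case False
    hence K: "s ^ (4 * t) + 1 \<noteq> 0" "u ^ (4 * t) + 1 \<noteq> 0" using zv zw eq by simp_all
    have "A ^ r \<noteq> 0" using A by simp
    hence inv: "(s ^ (4 * t) + 1) ^ (r + 1) / (s ^ (4 * t)) ^ r =
        (u ^ (4 * t) + 1) ^ (r + 1) / (u ^ (4 * t)) ^ r"
      using fv fw eq by (metis mult_left_cancel)
    obtain \<alpha> \<beta> \<gamma> \<delta> where F: "\<alpha> \<in> F" "\<beta> \<in> F" "\<gamma> \<in> F" "\<delta> \<in> F"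
      and mob: "\<gamma> * v + \<delta> \<noteq> 0" "w * (\<gamma> * v + \<delta>) = \<alpha> * v + \<beta>"
      using orbit_mobius[of v w] v' w' K inv unfolding s_def u_def F_def mem_Collect_eq by blast
    have v2: "(v ^ r) ^ r \<noteq> v" using K Kv by simp
    define y x where "y = v ^ (2 * t)" and "x = w ^ (2 * t)"
    have nz: "v \<noteq> 0" "w \<noteq> 0" "y \<noteq> 0" "x \<noteq> 0" using v' w' by (simp_all add: y_def x_def)
    have sgn: "\<mu> ^ (2 * t) = 1 \<or> \<mu> ^ (2 * t) = - 1" if "\<mu> \<in> F" "\<mu> \<noteq> 0" for \<mu>
      using F_root_sign[of \<mu>] that by (simp add: F_def)
    have cc: "c = b * (y + inverse y)" "c' = b * (x + inverse x)"
      using v' w' by (simp_all add: y_def x_def)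
    have "c' = c \<or> c' = - c"
      using mobius_monomial[OF v w v2 F mob]
    proof
      assume "\<alpha> = 0 \<and> \<delta> = 0"
      hence e: "w * v = \<beta> / \<gamma>" and "\<gamma> \<noteq> 0" using mob by (auto simp: field_simps)
      hence "w * v \<in> F" "w * v \<noteq> 0" using F_closed(4) F nz by auto
      from sgn[OF this] have "x * y = 1 \<or> x * y = - 1"
        by (simp only: x_def y_def power_mult_distrib)
      hence "x = inverse y \<or> x = - inverse y"
        using nz by (auto simp: field_simps)
      thus ?thesis unfolding cc by (auto simp: algebra_simps)
    next
      assume "\<beta> = 0 \<and> \<gamma> = 0"
      hence e: "w = \<alpha> / \<delta> * v" and "\<delta> \<noteq> 0" using mob by (auto simp: field_simps)
      hence "\<alpha> / \<delta> \<in> F" "\<alpha> / \<delta> \<noteq> 0" using F_closed(4) F nz by auto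
      hence "x = y \<or> x = - y"
        using sgn[of "\<alpha> / \<delta>"] unfolding x_def y_def e power_mult_distrib by auto
      thus ?thesis unfolding cc by (auto simp: algebra_simps)
    qed
    moreover have "c' \<noteq> - c"
    proof
      assume "c' = - c"
      hence "2 * fval c = 0" using eq fval_minus[of c] by simp
      thus False using two False by simp
    qed
    ultimately show ?thesis by simp
  qed
qed

end

section \<open>Exponents and base change\<close>

lemma Suc_power_eq_geometric: "Suc y ^ n = y * (\<Sum>i<n. Suc y ^ i) + 1"
  by (induction n) (simp_all add: algebra_simps)

lemma two_part_cofactor:
  fixes s s' P T t :: nat
  assumes "s * s' = P * T" "even s'" "odd T" "P dvd 4 * t" "s > 0"
  shows "\<exists>M o'. s * M = 2 * t * o' \<and> odd o'"
proof -
  obtain o' where o': "s = 2 ^ multiplicity 2 s * o'" "\<not> 2 dvd o'"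
    using multiplicity_decompose'[of s "2 :: nat"] assms(5) by auto
  define g where "g = multiplicity 2 s"
  have "2 ^ g dvd s" using o'(1) unfolding g_def[symmetric] by (rule dvdI)
  hence "2 ^ g * 2 dvd s * s'" using assms(2) by (rule mult_dvd_mono)
  moreover have "coprime (2 ^ g * 2) T" using assms(3) by (simp add: coprime_left_2_iff_odd)
  ultimately have "2 ^ g * 2 dvd P" unfolding assms(1) by (simp add: coprime_dvd_mult_left_iff)
  hence "2 ^ g * 2 dvd 4 * t" using assms(4) by (rule dvd_trans)
  moreover have "4 * t = (2 * t) * 2" by simp
  ultimately have "2 ^ g * 2 dvd (2 * t) * 2" by (simp only:)
  hence "2 ^ g dvd 2 * t" by (simp only: dvd_times_right_cancel_iff)
  then obtain M where "2 * t = 2 ^ g * M" by (elim dvdE)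
  hence "s * M = 2 * t * o'" using o'(1) unfolding g_def[symmetric] by (simp add: mult_ac)
  thus ?thesis using o'(2) by blast
qed

lemma odd_square_eq:
  fixes x :: nat
  assumes "odd x" "x \<ge> 3"
  obtains t where "x ^ 2 = 4 * t + 1" "t \<ge> 2"
proof -
  obtain j where j: "x = 2 * j + 1" using assms(1) by (elim oddE)
  have "j \<ge> 1" using j assms(2) by simp
  hence "j * (j + 1) \<ge> 1 * (1 + 1)" by (intro mult_le_mono) auto
  moreover have "x ^ 2 = 4 * (j * (j + 1)) + 1" by (simp add: j power2_eq_square algebra_simps)
  ultimately show ?thesis using that[of "j * (j + 1)"] by simp
qed

text \<open>
  With \<open>p0 = p\<^bsup>2^ord2(L)\<^esup>\<close>, \<open>Q\<close> is an odd power of \<open>p0\<close> and \<open>r\<close> a power of \<open>p0\<^sup>2\<close>, so \<open>Q\<^sup>2 - 1\<close> is an odd multiple of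
  the divisor \<open>p0\<^sup>2 - 1\<close> of \<open>r - 1\<close>.
\<close>

lemma frobenius_numbers:
  fixes p k L t :: nat
  assumes p: "odd p" "p > 1" and k: "k > 0" and L: "L > 0"
    and mult: "multiplicity 2 L \<le> multiplicity 2 k"
    and t: "p ^ (2 * k) = 4 * t + 1"
  shows "\<exists>M o'. (p ^ L + 1) * M = 2 * t * o' \<and> odd o'"
    and "\<exists>M o'. (p ^ L - 1) * M = 2 * t * o' \<and> odd o'"
    and "\<exists>e1 e2. (4 * t + 1) ^ e1 = (p ^ L) ^ e2 \<and> odd e1 \<and> even e2"
proof -
  define \<tau> where "\<tau> = multiplicity 2 L"
  obtain L1 where L1: "L = 2 ^ \<tau> * L1" "odd L1"
    using multiplicity_decompose'[of L "2 :: nat"] L unfolding \<tau>_def by auto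
  obtain k1 where k1: "k = 2 ^ \<tau> * k1"
    using multiplicity_dvd'[OF mult] unfolding \<tau>_def by (elim dvdE)
  define p0 where "p0 = p ^ (2 ^ \<tau>)"
  have p0: "odd p0" "p0 \<ge> 1" using p by (simp_all add: p0_def)
  have Q: "p ^ L = p0 ^ L1" by (simp add: L1(1) p0_def power_mult)
  have r: "4 * t + 1 = (p0 ^ 2) ^ k1"
    unfolding t[symmetric] k1 p0_def power_mult[symmetric] by (simp add: mult_ac)
  define P where "P = p0 ^ 2 - 1"
  have SP: "p0 ^ 2 = Suc P" using p0(2) by (simp add: P_def)
  have "4 * t = P * (\<Sum>i<k1. Suc P ^ i)"
    using Suc_power_eq_geometric[of P k1] r unfolding SP by simp
  hence P: "P dvd 4 * t" by simp
  define T where "T = (\<Sum>i<L1. Suc P ^ i)"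
  have "odd (Suc P)" unfolding SP[symmetric] using p0 by simp
  hence "{i \<in> {..<L1}. odd (Suc P ^ i)} = {..<L1}" by (auto simp del: power_Suc)
  hence "odd T" unfolding T_def using L1(2) by (subst even_sum_iff) simp_all
  have "(p ^ L) ^ 2 = Suc P ^ L1" unfolding Q SP[symmetric] by (simp only: power_mult[symmetric] mult.commute)
  hence QQ: "(p ^ L) ^ 2 = P * T + 1" unfolding T_def using Suc_power_eq_geometric[of P L1] by simp
  have "odd (p ^ L)" using p by simp
  have "p ^ L > 1" using one_less_power[OF p(2) L] .
  have "(p ^ L + 1) * (p ^ L - 1) = (p ^ L) ^ 2 - 1"
    by (simp add: power2_eq_square algebra_simps)
  hence e: "(p ^ L + 1) * (p ^ L - 1) = P * T" using QQ by simp
  show "\<exists>M o'. (p ^ L + 1) * M = 2 * t * o' \<and> odd o'"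
    by (rule two_part_cofactor[OF e _ \<open>odd T\<close> P]) (use \<open>odd (p ^ L)\<close> in simp_all)
  show "\<exists>M o'. (p ^ L - 1) * M = 2 * t * o' \<and> odd o'"
    by (rule two_part_cofactor[OF e[unfolded mult.commute[of "p ^ L + 1"]] _ \<open>odd T\<close> P])
      (use \<open>odd (p ^ L)\<close> \<open>p ^ L > 1\<close> in simp_all)
  have "(4 * t + 1) ^ L1 = (p ^ L) ^ (2 * k1)"
    unfolding r Q power_mult[symmetric] by (simp only: ac_simps)
  thus "\<exists>e1 e2. (4 * t + 1) ^ e1 = (p ^ L) ^ e2 \<and> odd e1 \<and> even e2"
    using L1(2) by (metis dvd_triv_left)
qed

lemma CHAR_finite_field_eq:
  assumes "prime p" "CARD('a :: finite_field) = p ^ l"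
  shows "CHAR('a) = p"
proof -
  have "CHAR('a) dvd p ^ l"
    using of_nat_CARD_finite_field[where ?'a = 'a] assms(2) of_nat_eq_0_iff_char_dvd by metis
  hence "CHAR('a) dvd p" using CHAR_prime prime_dvd_power_nat by blast
  thus ?thesis using assms(1) CHAR_prime by (metis primes_dvd_imp_eq)
qed

lemma ext_field_1: "ext_field 1 = range (to_ac :: 'a :: finite_field \<Rightarrow> _)"
proof (rule ext_field_unique[symmetric])
  show "card (range (to_ac :: 'a \<Rightarrow> _)) = CARD('a) ^ 1" by (simp add: card_image inj_to_ac)
  fix x y :: "'a alg_closure"
  assume "x \<in> range to_ac" "y \<in> range to_ac"
  then obtain x' y' where "x = to_ac x'" "y = to_ac y'" by (elim rangeE)
  hence "x * y = to_ac (x' * y')" by simp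
  thus "x * y \<in> range to_ac" by (rule range_eqI)
next
  show "(0 :: 'a alg_closure) \<in> range to_ac" by (rule range_eqI[of _ _ 0]) simp
qed simp

lemma poly_map_poly_to_ac_ext_field:
  assumes "x \<in> ext_field n"
  shows "poly (map_poly to_ac p) x \<in> ext_field n"
proof (induction p)
  case 0
  show ?case using ext_field_subfield(1) by simp
next
  case (pCons c p)
  have "to_ac c + x * poly (map_poly to_ac p) x \<in> ext_field n"
    by (intro ext_field_subfield(3,5,7) assms pCons)
  thus ?case by (simp add: map_poly_pCons)
qed

lemma poly_map_poly_to_ac_power_CARD:
  fixes p :: "'a :: finite_field poly"
  shows "poly (map_poly to_ac p) x ^ CARD('a) = poly (map_poly to_ac p) (x ^ CARD('a))"
  by (induction p)
     (simp_all add: map_poly_pCons alg_closure_add_power_CARD power_mult_distrib to_ac_power_CARD)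

lemma coprime_map_poly_to_acD:
  fixes P Q :: "'a :: field poly"
  assumes "coprime (map_poly to_ac P) (map_poly to_ac Q)"
  shows "coprime P Q"
proof (rule coprimeI)
  fix w assume "w dvd P" "w dvd Q"
  hence "map_poly to_ac w dvd map_poly to_ac P" "map_poly to_ac w dvd map_poly to_ac Q"
    by (auto elim!: dvdE simp: map_poly_to_ac_mult)
  hence "is_unit (map_poly to_ac w)" using assms by (meson coprime_common_divisor)
  moreover from this have "map_poly to_ac w \<noteq> 0" by auto
  ultimately have "map_poly to_ac w \<noteq> 0" "degree (map_poly to_ac w) = 0"
    by (simp_all add: is_unit_iff_degree)
  hence "w \<noteq> 0" "degree w = 0" by (auto simp: degree_map_poly_to_ac)
  thus "is_unit w" by (simp add: is_unit_iff_degree)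
qed

lemma nonsquare_sqrt_power_CARD:
  fixes a :: "'a :: finite_field"
  assumes "\<not> (\<exists>c. a = c ^ 2)" "b ^ 2 = to_ac a"
  shows "b ^ CARD('a) = - b"
proof -
  have "(b ^ CARD('a)) ^ 2 = (b ^ 2) ^ CARD('a)" by (simp only: power_mult[symmetric] mult.commute)
  also have "\<dots> = b ^ 2" unfolding assms(2) by (rule to_ac_power_CARD)
  finally have "b ^ CARD('a) = b \<or> b ^ CARD('a) = - b" by (simp only: power2_eq_iff)
  moreover have "b ^ CARD('a) \<noteq> b"
  proof
    assume "b ^ CARD('a) = b"
    hence "b \<in> ext_field 1" by (simp add: ext_field_def)
    then obtain c where "b = to_ac c" unfolding ext_field_1 by blast
    hence "to_ac a = to_ac (c ^ 2)" using assms(2) by simp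
    hence "a = c ^ 2" by (simp only: to_ac_eq_iff)
    thus False using assms(1) by blast
  qed
  ultimately show ?thesis by blast
qed

locale dickson_finite_field =
  fixes a :: "'a :: finite_field" and p k l t :: nat
  assumes p: "prime p" "odd p" and k: "k > 0" and l: "l > 0"
    and card: "CARD('a) = p ^ l" and r: "p ^ (2 * k) = 4 * t + 1" and t: "t \<ge> 2"
    and a: "a \<noteq> 0" and nonsquare: "\<not> (\<exists>c. a = c ^ 2)"
    and multiplicity_le: "multiplicity 2 l \<le> multiplicity 2 k"
begin

abbreviation A :: "'a alg_closure" where "A \<equiv> to_ac a"

definition num :: "'a poly" where "num = dickson2 (4 * t + 1) a ^ (2 * t + 1)"

definition den :: "'a poly" where "den = [:- 4 * a, 0, 1:] ^ (t * (4 * t + 1))"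

definition num_ac :: "'a alg_closure poly" where "num_ac = dickson2 (4 * t + 1) A ^ (2 * t + 1)"

definition den_ac :: "'a alg_closure poly" where "den_ac = [:- 4 * A, 0, 1:] ^ (t * (4 * t + 1))"

lemma p_gt_1: "p > 1"
  using p(1) by (rule prime_gt_1_nat)

lemma CHAR_ac: "CHAR('a alg_closure) = p"
  using CHAR_finite_field_eq[where ?'a = 'a] p(1) card by simp

lemma frobenius: "(x + y) ^ (p ^ j) = x ^ (p ^ j) + y ^ (p ^ j)" for x y :: "'a alg_closure"
  using freshmans_dream'[where ?'a = "'a alg_closure"] p(1) unfolding CHAR_ac by simp

lemma two_nonzero: "(2 :: 'a alg_closure) \<noteq> 0"
proof
  assume "(2 :: 'a alg_closure) = 0"
  hence "of_nat 2 = (0 :: 'a alg_closure)" by simp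
  hence "p dvd 2" using of_nat_eq_0_iff_char_dvd[where ?'a = "'a alg_closure", of 2] CHAR_ac by metis
  hence "p \<le> 2" by (rule dvd_imp_le) simp
  hence "p = 2" using p_gt_1 by simp
  thus False using p(2) by simp
qed

lemma two_power: "(2 :: 'a alg_closure) ^ (p ^ j) = 2"
  using frobenius[of 1 1 j] by simp

lemma dickson_alg_closed_ac: "dickson_alg_closed A t"
proof
  show "(x + y) ^ (4 * t + 1) = x ^ (4 * t + 1) + y ^ (4 * t + 1)" for x y :: "'a alg_closure"
    using frobenius[of x y "2 * k"] unfolding r .
  have "p dvd 4 * t + 1" unfolding r[symmetric] using k by (simp add: dvd_power)
  thus "of_nat (4 * t + 1) = (0 :: 'a alg_closure)" using CHAR_ac of_nat_eq_0_iff_char_dvd by blast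
qed (use t two_nonzero a in simp_all)

lemma sqrt_exists: "\<exists>b. b ^ 2 = A"
  by (rule nth_root_exists) simp

lemma dickson_quotient_ac:
  assumes "b ^ 2 = A"
  shows "dickson_quotient (dickson2 (4 * t + 1) A) t (2 * b)"
  by (rule dickson_alg_closed.dickson_quotient_E[OF dickson_alg_closed_ac]) (simp add: power_mult_distrib assms)

lemma sqrt_power_CARD: "b ^ CARD('a) = - b" if "b ^ 2 = A"
  using nonsquare_sqrt_power_CARD[OF nonsquare that] .

lemma map_num: "map_poly to_ac num = num_ac"
  unfolding num_def num_ac_def map_poly_to_ac_power map_poly_to_ac_dickson2 ..

lemma map_den: "map_poly to_ac den = den_ac"
proof -
  have "map_poly to_ac [:- 4 * a, 0, 1:] = [:- 4 * A, 0, 1:]" by (simp add: map_poly_pCons)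
  thus ?thesis unfolding den_def den_ac_def map_poly_to_ac_power by simp
qed

lemma den_ac_eq: "den_ac = ([:-(2 * b), 1:] * [:2 * b, 1:]) ^ (t * (4 * t + 1))" if "b ^ 2 = A"
proof -
  have "[:-(2 * b), 1:] * [:2 * b, 1:] = [:- 4 * A, 0, 1:]"
    unfolding that[symmetric] by (simp add: power2_eq_square)
  thus ?thesis by (simp only: den_ac_def)
qed

lemma coprime_ac: "coprime num_ac den_ac"
proof -
  obtain b where b: "b ^ 2 = A" using sqrt_exists by blast
  show ?thesis unfolding num_ac_def den_ac_eq[OF b]
    by (rule dickson_quotient.coprime_num_den[OF dickson_quotient_ac[OF b]])
qed

lemma coprime_num_den: "coprime num den"
  by (rule coprime_map_poly_to_acD) (simp only: map_num map_den coprime_ac)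

lemma lead_coeff_den: "lead_coeff den = 1" "lead_coeff den_ac = 1"
  unfolding den_def den_ac_def lead_coeff_power by simp_all

lemma den_nonzero: "den \<noteq> 0" "den_ac \<noteq> 0"
  using lead_coeff_den by auto

lemma degree_ac:
  "degree num_ac = (4 * t + 1) * (2 * t + 1)" "degree den_ac = 2 * (t * (4 * t + 1))"
proof -
  have "dickson2 (4 * t + 1) A \<noteq> 0" using degree_dickson2[of "4 * t + 1" A] by auto
  from degree_power_eq[OF this] show "degree num_ac = (4 * t + 1) * (2 * t + 1)"
    unfolding num_ac_def degree_dickson2 by (simp only: mult.commute)
  show "degree den_ac = 2 * (t * (4 * t + 1))" unfolding den_ac_def by (simp add: degree_power_eq)
qed

lemma degree_den_less: "degree den_ac < degree num_ac"
  unfolding degree_ac by simp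

lemma num_nonzero: "num_ac \<noteq> 0" "num \<noteq> 0"
proof -
  show "num_ac \<noteq> 0" using degree_den_less by auto
  thus "num \<noteq> 0" using map_num by auto
qed

lemma rf_to_ac_eq: "rf_to_ac (Fract num den) = Fract num_ac den_ac"
  unfolding rf_to_ac_Fract[OF den_nonzero(1)] map_num map_den ..

lemmas rf_simps = rf_num_Fract[OF coprime_num_den lead_coeff_den(1)]
  rf_den_Fract[OF coprime_num_den lead_coeff_den(1)]
  rf_num_Fract[OF coprime_ac lead_coeff_den(2)] rf_den_Fract[OF coprime_ac lead_coeff_den(2)]

lemma rf_degree_ac: "rf_degree (Fract num_ac den_ac) = (4 * t + 1) * (2 * t + 1)"
  unfolding rf_degree_def rf_simps using degree_den_less degree_ac by simp

lemma rf_degree: "rf_degree (Fract num den) = (4 * t + 1) * (2 * t + 1)"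
proof -
  have "degree num = degree num_ac" "degree den = degree den_ac"
    unfolding map_num[symmetric] map_den[symmetric] degree_map_poly_to_ac by simp_all
  thus ?thesis using rf_degree_ac unfolding rf_degree_def rf_simps by simp
qed

lemma rf_indecomposable: "rf_indecomposable (Fract num den)"
  unfolding rf_indecomposable_def
proof (intro conjI notI)
  show "2 \<le> rf_degree (Fract num den)" unfolding rf_degree using t by simp
  assume "\<exists>g h. 2 \<le> rf_degree g \<and> 2 \<le> rf_degree h \<and> Fract num den = rf_compose g h"
  then obtain g h where gh: "2 \<le> rf_degree g" "2 \<le> rf_degree h" "Fract num den = rf_compose g h"
    by blast
  obtain b where b: "b ^ 2 = A" using sqrt_exists by blast
  define \<beta> where "\<beta> = 2 * b"
  have \<beta>q: "\<beta> ^ CARD('a) = - \<beta>"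
    unfolding \<beta>_def power_mult_distrib sqrt_power_CARD[OF b] unfolding card two_power by simp
  define H1 H2 n where "H1 = map_poly to_ac (rf_num h)" and "H2 = map_poly to_ac (rf_den h)"
    and "n = rf_degree h"
  define V where "V = smult (coeff (rf_den h) n) (rf_num h) - smult (coeff (rf_num h) n) (rf_den h)"
  have V: "smult (coeff H2 n) H1 - smult (coeff H1 n) H2 = map_poly to_ac V"
    by (simp add: V_def H1_def H2_def map_poly_to_ac_diff map_poly_to_ac_smult coeff_map_poly)
  note hom = rf_compose_homog[OF gh(3) num_nonzero(2) den_nonzero(1)]
  have "t = 2 \<and> (poly (smult (coeff H2 n) H1 - smult (coeff H1 n) H2) \<beta> = 0 \<longleftrightarrow>
                  poly (smult (coeff H2 n) H1 - smult (coeff H1 n) H2) (- \<beta>) \<noteq> 0)"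
  proof (rule dickson_quotient.homog_decomposition[OF dickson_quotient_ac[OF b], folded \<beta>_def])
    show "coprime (map_poly to_ac (rf_num g)) (map_poly to_ac (rf_den g))" "coprime H1 H2"
      unfolding H1_def H2_def by (intro coprime_map_poly_to_ac coprime_rf_num_den)+
    show "dickson2 (4 * t + 1) A ^ (2 * t + 1) * homog (rf_degree g) (map_poly to_ac (rf_den g)) H1 H2 =
        homog (rf_degree g) (map_poly to_ac (rf_num g)) H1 H2 *
        ([:-\<beta>, 1:] * [:\<beta>, 1:]) ^ (t * (4 * t + 1))"
      using arg_cong[OF hom(1), of "map_poly to_ac"]
      unfolding H1_def H2_def map_poly_to_ac_mult map_poly_to_ac_homog map_num map_den
      unfolding num_ac_def den_ac_eq[OF b] \<beta>_def .
    have "map_poly to_ac (homog (rf_degree g) (rf_den g) (rf_num h) (rf_den h)) \<noteq> 0"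
      using hom(2) by (simp add: map_poly_eq_0_iff)
    thus "homog (rf_degree g) (map_poly to_ac (rf_den g)) H1 H2 \<noteq> 0"
      unfolding H1_def H2_def map_poly_to_ac_homog .
  qed (use gh in \<open>simp_all add: rf_degree_def H1_def H2_def n_def degree_map_poly_to_ac\<close>)
  hence xor: "poly (map_poly to_ac V) \<beta> = 0 \<longleftrightarrow> poly (map_poly to_ac V) (- \<beta>) \<noteq> 0"
    unfolding V by blast
  have "poly (map_poly to_ac V) \<beta> = 0 \<longleftrightarrow> poly (map_poly to_ac V) \<beta> ^ CARD('a) = 0"
    by simp
  also have "\<dots> \<longleftrightarrow> poly (map_poly to_ac V) (- \<beta>) = 0"
    unfolding poly_map_poly_to_ac_power_CARD \<beta>q ..
  finally show False using xor by blast
qed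

lemma rf_indecomposable_ac:
  assumes "t \<noteq> 2"
  shows "rf_indecomposable (Fract num_ac den_ac)"
  unfolding rf_indecomposable_def
proof (intro conjI notI)
  show "2 \<le> rf_degree (Fract num_ac den_ac)" unfolding rf_degree_ac using t by simp
  assume "\<exists>g h. 2 \<le> rf_degree g \<and> 2 \<le> rf_degree h \<and> Fract num_ac den_ac = rf_compose g h"
  then obtain g h where gh: "2 \<le> rf_degree g" "2 \<le> rf_degree h" "Fract num_ac den_ac = rf_compose g h"
    by blast
  obtain b where b: "b ^ 2 = A" using sqrt_exists by blast
  note hom = rf_compose_homog[OF gh(3) num_nonzero(1) den_nonzero(2)]
  have "t = 2"
    using dickson_quotient.homog_decomposition[OF dickson_quotient_ac[OF b] coprime_rf_num_den _ gh(1) coprime_rf_num_den _ gh(2)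
        hom(1)[unfolded num_ac_def den_ac_eq[OF b]] hom(2)] by (simp only: rf_degree_def)
  thus False using assms by simp
qed

lemma odd_CARD_power: "odd (CARD('a) ^ n)"
  unfolding card using p(2) by simp

lemma sqrt_power: "b ^ (CARD('a) ^ n) = - b" if b: "b ^ 2 = A" and n: "odd n"
proof -
  have "b ^ (CARD('a) ^ j) = (- 1) ^ j * b" for j
  proof (induction j)
    case (Suc j)
    have s: "((- 1) ^ j) ^ CARD('a) = (- 1 :: 'a alg_closure) ^ j"
      using odd_CARD_power[of 1] by (simp flip: power_mult add: minus_one_power_iff)
    have "b ^ (CARD('a) ^ Suc j) = (b ^ (CARD('a) ^ j)) ^ CARD('a)"
      by (simp only: power_Suc2 power_mult)
    thus ?case unfolding Suc power_mult_distrib s sqrt_power_CARD[OF b] by simp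
  qed simp
  thus ?thesis using n by simp
qed

lemma dickson_frobenius_exists:
  assumes b: "b ^ 2 = A" and n: "odd n"
  shows "\<exists>M1 o1 M2 o2 e1 e2. dickson_frobenius A t b (CARD('a) ^ n) M1 o1 M2 o2 e1 e2"
proof -
  define N where "N = CARD('a) ^ n"
  have N: "N = p ^ (l * n)" by (simp add: N_def card power_mult)
  have n0: "n > 0" using n by (cases n) auto
  hence ln: "l * n > 0" using l by simp
  have "multiplicity 2 (l * n) = multiplicity 2 l + multiplicity 2 n"
    using l n0 by (intro prime_elem_multiplicity_mult_distrib) auto
  hence "multiplicity 2 (l * n) \<le> multiplicity 2 k"
    using multiplicity_le n by (simp add: not_dvd_imp_multiplicity_0)
  note nums = frobenius_numbers[OF p(2) p_gt_1 k ln this r, folded N]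
  obtain M1 o1 where M1: "(N + 1) * M1 = 2 * t * o1" "odd o1" using nums(1) by blast
  obtain M2 o2 where M2: "(N - 1) * M2 = 2 * t * o2" "odd o2" using nums(2) by blast
  obtain e1 e2 where e: "(4 * t + 1) ^ e1 = N ^ e2" "odd e1" "even e2" using nums(3) by blast
  have "(x + y) ^ N = x ^ N + y ^ N" for x y :: "'a alg_closure" unfolding N by (rule frobenius)
  hence "dickson_frobenius A t b N M1 o1 M2 o2 e1 e2"
    using dickson_alg_closed_ac b sqrt_power[OF b n] odd_CARD_power[of n] M1 M2 e unfolding N_def
    by (intro dickson_frobenius.intro dickson_frobenius_axioms.intro)
  thus ?thesis unfolding N_def by blast
qed

lemma poly_den_ac: "poly den_ac c = (c ^ 2 - 4 * A) ^ (t * (4 * t + 1))"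
proof -
  have "poly [:- 4 * A, 0, 1:] c = c ^ 2 - 4 * A" by (simp add: power2_eq_square)
  thus ?thesis unfolding den_ac_def poly_power by simp
qed

lemma poly_den_ac_nonzero:
  assumes c: "c \<in> ext_field n" and n: "odd n"
  shows "poly den_ac c \<noteq> 0"
proof
  assume "poly den_ac c = 0"
  hence "c ^ 2 - 4 * A = 0" unfolding poly_den_ac power_eq_0_iff by blast
  moreover obtain b where b: "b ^ 2 = A" using sqrt_exists by blast
  have "(2 * b) ^ 2 = 4 * A" unfolding power_mult_distrib b by simp
  ultimately have "c ^ 2 = (2 * b) ^ 2" by (simp only: right_minus_eq)
  hence c2: "c = 2 * b \<or> c = - (2 * b)" by (simp only: power2_eq_iff)
  have "(2 * b) ^ (CARD('a) ^ n) = - (2 * b)"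
    unfolding power_mult_distrib sqrt_power[OF b n] unfolding card power_mult[symmetric] two_power
    by simp
  hence "c ^ (CARD('a) ^ n) = - c"
    using c2 power_minus_odd[OF odd_CARD_power[of n], of "2 * b"] by (elim disjE) simp_all
  hence "c = - c" using c by (simp only: ext_field_def mem_Collect_eq)
  hence "2 * b = - (2 * b)" using c2 by (elim disjE) (simp_all only: minus_minus)
  thus False using dickson_quotient.beta[OF dickson_quotient_ac[OF b]] by simp
qed

lemma quotient_inj:
  assumes c: "c \<in> ext_field n" "c' \<in> ext_field n" and n: "odd n"
    and eq: "poly num_ac c / poly den_ac c = poly num_ac c' / poly den_ac c'"
  shows "c = c'"
proof -
  obtain b where b: "b ^ 2 = A" using sqrt_exists by blast
  obtain M1 o1 M2 o2 e1 e2 where frob: "dickson_frobenius A t b (CARD('a) ^ n) M1 o1 M2 o2 e1 e2"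
    using dickson_frobenius_exists[OF b n] by blast
  have fval: "dickson_frobenius.fval A t x = poly num_ac x / poly den_ac x" for x
    unfolding dickson_frobenius.fval_def[OF frob] poly_den_ac num_ac_def poly_power ..
  show ?thesis
    by (rule dickson_frobenius.fval_inj[OF frob])
       (use c in \<open>simp_all only: ext_field_def mem_Collect_eq fval eq\<close>)
qed

lemma quotient_ext_field:
  assumes "c \<in> ext_field n"
  shows "poly num_ac c / poly den_ac c \<in> ext_field n"
  unfolding divide_inverse map_num[symmetric] map_den[symmetric]
  by (intro ext_field_subfield(5,6) poly_map_poly_to_ac_ext_field assms)

lemma rf_eval_Aff:
  assumes "c \<in> ext_field n" "odd n"
  shows "rf_eval (Fract num_ac den_ac) (Aff c) = Aff (poly num_ac c / poly den_ac c)"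
  unfolding rf_eval.simps rf_simps proj_point_def using poly_den_ac_nonzero[OF assms] by simp

lemma rf_eval_Infinity: "rf_eval (Fract num_ac den_ac) Infinity = Infinity"
proof -
  have "coeff den_ac (rf_degree (Fract num_ac den_ac)) = 0"
    using degree_den_less degree_ac rf_degree_ac by (simp add: coeff_eq_0)
  thus ?thesis unfolding rf_eval.simps proj_point_def rf_simps by simp
qed

lemma rf_permutes_ext:
  assumes n: "odd n"
  shows "rf_permutes_ext (Fract num den) n"
proof -
  define F where "F = rf_eval (Fract num_ac den_ac)"
  have n0: "n > 0" using n by (cases n) auto
  have Aff: "F (Aff c) = Aff (poly num_ac c / poly den_ac c)" if "c \<in> ext_field n" for c
    unfolding F_def using rf_eval_Aff[OF that n] .
  have Inf: "F Infinity = Infinity" unfolding F_def by (rule rf_eval_Infinity)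
  have "finite (ext_field n :: 'a alg_closure set)"
    using card_ext_field[OF n0, where ?'a = 'a] by (intro card_ge_0_finite) simp
  hence fin: "finite (proj_line_ext n :: 'a alg_closure proj_line set)"
    unfolding proj_line_ext_def by simp
  have image: "F ` proj_line_ext n \<subseteq> proj_line_ext n"
    unfolding proj_line_ext_def by (auto simp: Aff Inf quotient_ext_field)
  have inj: "inj_on F (proj_line_ext n)"
    unfolding proj_line_ext_def by (rule inj_onI) (auto simp: Aff Inf intro: quotient_inj[OF _ _ n])
  show ?thesis using endo_inj_surj[OF fin image inj] inj
    unfolding rf_permutes_ext_def bij_betw_def rf_to_ac_eq F_def by blast
qed

lemma rf_exceptional: "rf_exceptional (Fract num den)"
proof -
  have "range (\<lambda>j. 2 * j + 1 :: nat) \<subseteq> {n. n > 0 \<and> rf_permutes_ext (Fract num den) n}"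
    using rf_permutes_ext by auto
  moreover have "infinite (range (\<lambda>j. 2 * j + 1 :: nat))"
    by (rule range_inj_infinite) (simp add: inj_def)
  ultimately show ?thesis unfolding rf_exceptional_def using infinite_super by blast
qed

end

theorem theorem1p7:
  fixes p k l r q :: nat
    and a :: "'a :: finite_field"
    and f :: "'a poly fract"
  assumes "prime p" and "odd p"
    and "k > 0" and "l > 0"
    and "r = p ^ (2 * k)" and "q = p ^ l"
    and "multiplicity 2 l \<le> multiplicity 2 k"
    and "CARD('a) = q"
    and "a \<noteq> 0" and "\<not> (\<exists>b. a = b ^ 2)"
    and "f = Fract (dickson2 r a ^ ((r + 1) div 2))
                   ([:- 4 * a, 0, 1:] ^ ((r ^ 2 - r) div 4))"
  shows "rf_indecomposable f \<and> rf_exceptional f \<and>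
         rf_degree f = (r ^ 2 + r) div 2 \<and>
         (\<forall>n. odd n \<longrightarrow> rf_permutes_ext f n) \<and>
         (r \<noteq> 9 \<longrightarrow> rf_indecomposable (rf_to_ac f))"
proof -
  have "p > 1" using assms(1) by (rule prime_gt_1_nat)
  moreover have "p \<noteq> 2" using assms(2) by auto
  ultimately have "p \<ge> 3" by simp
  moreover have "p ^ 1 \<le> p ^ k" using \<open>p > 1\<close> assms(3) by (intro power_increasing) auto
  ultimately have "p ^ k \<ge> 3" "odd (p ^ k)" using assms(2) by simp_all
  then obtain t where t: "(p ^ k) ^ 2 = 4 * t + 1" "t \<ge> 2" using odd_square_eq by blast
  have r: "p ^ (2 * k) = 4 * t + 1" using t(1) by (metis power_mult mult.commute)
  hence rt: "r = 4 * t + 1" using assms(5) by simp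
  have "r ^ 2 - r = 4 * (t * (4 * t + 1))" unfolding rt by (simp add: power2_eq_square algebra_simps)
  moreover have "r ^ 2 + r = 2 * ((4 * t + 1) * (2 * t + 1))"
    unfolding rt by (simp add: power2_eq_square algebra_simps)
  ultimately have exps: "(r + 1) div 2 = 2 * t + 1" "(r ^ 2 - r) div 4 = t * (4 * t + 1)"
    "(r ^ 2 + r) div 2 = (4 * t + 1) * (2 * t + 1)" by (simp_all add: rt)
  have D: "dickson_finite_field a p k l t"
    using assms t(2) r by (intro dickson_finite_field.intro) simp_all
  note dfs = dickson_finite_field.num_def[OF D] dickson_finite_field.den_def[OF D]
  have f: "f = Fract (dickson_finite_field.num a t) (dickson_finite_field.den a t)"
    unfolding assms(11) exps dfs unfolding rt ..
  have "rf_indecomposable (rf_to_ac f)" if "r \<noteq> 9"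
    unfolding f dickson_finite_field.rf_to_ac_eq[OF D]
    by (rule dickson_finite_field.rf_indecomposable_ac[OF D]) (use that rt in simp)
  thus ?thesis
    using dickson_finite_field.rf_indecomposable[OF D] dickson_finite_field.rf_exceptional[OF D]
      dickson_finite_field.rf_degree[OF D] dickson_finite_field.rf_permutes_ext[OF D]
    unfolding f exps by blast
qed

end
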